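(* For the category with covering families $\mathbf{Mat}^{\mathrm{tc}}=(\mathbf{Mat}_+,\mathcal{S}^{\mathrm{tc}},\ast)$ the following holds: (i) There is a canonical isomorphism of abelian groups $$\rho: K_0(\mathbf{Mat}^{\mathrm{tc}}) \stackrel{\cong}{\longrightarrow} \mathbb{Z}[x,y].$$ (ii) Via the identifications $K_0(\mathbf{Mat}^{\cong}) = \mathbb{Z}[\mathcal{M}]$ and $K_0(\mathbf{Mat}^{\mathrm{tc}})\cong \mathbb{Z}[x,y]$ (the latter given by $\rho$), the homomorphism $\gamma: K_0(\mathbf{Mat}^{\cong}) \rightarrow K_0(\mathbf{Mat}^{\mathrm{tc}})$ induced by the morphism $\Gamma: \mathbf{Mat}^{\cong} \rightarrow \mathbf{Mat}^{\mathrm{tc}}$ is the group homomorphism $\mathcal{T}: \mathbb{Z}[\mathcal{M}] \rightarrow \mathbb{Z}[x,y]$ which maps an isomorphism class $[M]$ to its Tutte polynomial $T(M;x,y)$; that is, $\rho\circ\gamma=\mathcal{T}$.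
   Context: **Matroids.** A matroid $M=(E,\mathcal{I})$ is a finite set $E$ (ground set) with a collection $\mathcal{I}$ of subsets (independent sets) such that $\varnothing\in\mathcal{I}$; subsets of independent sets are independent; and if $I,J\in\mathcal{I}$ with $|J|<|I|$ there is $x\in I- J$ with $J\cup\{x\}\in\mathcal{I}$. A basis is a maximal independent set. An element $e\in E$ is a loop if $\{e\}\notin\mathcal{I}$, an isthmus if it lies in every basis, and non-degenerate if it is neither. If $e$ is not an isthmus, the deletion $M\backslash e$ is the matroid on $E-\{e\}$ whose independent sets are the $I\subseteq E-\{e\}$ with $I\in\mathcal{I}$. If $e$ is not a loop, the contraction $M/e$ is the matroid on $E-\{e\}$ whose independent sets are the $I\subseteq E-\{e\}$ with $I\cup\{e\}\in\mathcal{I}$. A minor of $M$ is a matroid obtained by a sequence of deletions and/or contractions. An isomorphism of matroids is a bijection $f$ of ground sets such that $I$ is independent iff $f(I)$ is. $\mathcal{M}$ denotes the set of isomorphism classes of matroids, and $\mathbb{Z}[\mathcal{M}]$ the free abelian group on it. **Tutte polynomial.** $T(M;x,y)\in\mathbb{Z}[x,y]$ is the isomorphism invariant defined recursively by: $T(M;x,y)=T(M\backslash e;x,y)+T(M/e;x,y)$ if $e$ is non-degenerate; $T(M;x,y)=x\,T(M/e;x,y)$ if $e$ is an isthmus; $T(M;x,y)=y\,T(M\backslash e;x,y)$ if $e$ is a loop; $T(\varnothing;x,y)=1$ for the empty matroid $\varnothing$. **Category of matroids.** $\mathbf{Mat}$ has as objects the matroids with ground set $E\subset\{1,2,\ldots\}$;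 a morphism $(E_1,\mathcal{I}_1)\to(E_2,\mathcal{I}_2)$ is an injective function $f:E_1\to E_2$ with $f(I)\in\mathcal{I}_2$ for all $I\in\mathcal{I}_1$. If $M'$ is a minor of $M$, the morphism $M'\to M$ given by the inclusion of ground sets is the standard inclusion. $\mathbf{Mat}_+$ is obtained from $\mathbf{Mat}$ by adding a disjoint base-point object $\ast$ (distinct from the empty matroid): the only endomorphism of $\ast$ is the identity, and there are no morphisms between $\ast$ and objects of $\mathbf{Mat}$ in either direction. **Categories with covering families.** A multi-morphism in a small category is a finite (possibly empty) multi-set of morphisms $\{f_i:C_i\to B\}_{i\in I}$ with common target. Let $\mathcal{C}$ be a small category with a base-point object $\ast$ such that $\mathcal{C}(\ast,\ast)=\{\mathrm{Id}_\ast\}$ and $\mathcal{C}(C,\ast)=\varnothing$ for $C\neq\ast$. A covering family structure on $\mathcal{C}$ is a collection $\mathcal{S}$ of multi-morphisms (covering families) such that: (i) $\{\ast\to\ast\}_{i\in I}\in\mathcal{S}$ for every finite (possibly empty) set $I$; (ii) $\{\mathrm{Id}_C\}\in\mathcal{S}$ for every object $C$; (iii) if $\{g_j:B_j\to C\}_{j\in J}\in\mathcal{S}$ and $\{f_{ij}:A_{ij}\to B_j\}_{i\in I_j}\in\mathcal{S}$ for each $j\in J$, then $\{g_j\circ f_{ij}:A_{ij}\to C\}_{j\in J,i\in I_j}\in\mathcal{S}$. The triple $(\mathcal{C},\mathcal{S},\ast)$ is a category with covering families. A morphism of such triples is a functor preserving base-points and mapping covering families to covering families. **$K_0$.** To a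 category with covering families $\mathcal{C}$, Bohmann–Gerhardt–Malkiewich–Merling–Zakharevich associate functorially a $K$-theory spectrum $K(\mathcal{C})$; $K_0(\mathcal{C}):=\pi_0K(\mathcal{C})$. By a known theorem of theirs, $K_0(\mathcal{C})$ is the free abelian group on the objects of $\mathcal{C}$ modulo the relations $[A]=\sum_{j\in J}[A_j]$ for every covering family $\{A_j\to A\}_{j\in J}$ in $\mathcal{S}$ (in particular $[\ast]=0$); a morphism $F$ induces $[A]\mapsto[F(A)]$. This presentation may be taken as the definition of $K_0$. **The structure $\mathcal{S}^{\cong}$.** It consists of all finite (possibly empty) families $\{\ast\to\ast\}_{i\in I}$ and all singletons $\{f:M\to N\}$ with $f$ an isomorphism in $\mathbf{Mat}_+$. Set $\mathbf{Mat}^{\cong}=(\mathbf{Mat}_+,\mathcal{S}^{\cong},\ast)$. Then $K_0(\mathbf{Mat}^{\cong})=\mathbb{Z}[\mathcal{M}]$, with the class of a matroid $M$ corresponding to its isomorphism class $[M]$. **The structure $\mathcal{S}^{\mathrm{tc}}$.** All rooted binary trees $T$ are finite; each vertex has at most two children; a vertex with no descendants is a leaf, otherwise it is internal; $\bullet_T$ is the root. $\mathcal{C}_T$ is the poset category on the vertices of $T$ with $w\leq v$ iff $w=v$ or $w$ is a descendant of $v$. An elementary deletion-contraction tree of shape $T$ is a functor $\mathcal{F}:\mathcal{C}_T\to\mathbf{Mat}_+$ such that: (i) $\mathcal{F}(\bullet_T)\neq\ast$; (ii) if an internal vertex $v$ has only one child $w$, then $\mathcal{F}(w)=\mathcal{F}(v)$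 and $\mathcal{F}(w\to v)=\mathrm{Id}$; (iii) if an internal vertex $v$ has two children $w_1,w_2$, there is a non-degenerate element $e$ of $N:=\mathcal{F}(v)$ such that $\{\mathcal{F}(w_1),\mathcal{F}(w_2)\}$ are $N/e$ and $N\backslash e$ (one for each child, in either order), with $\mathcal{F}(w_1\to v)$ and $\mathcal{F}(w_2\to v)$ the standard inclusions into $N$. A deletion-contraction tree of shape $T$ is a functor $\mathcal{C}_T\to\mathbf{Mat}_+$ naturally isomorphic to an elementary one; it is rooted at $M$ if its value at $\bullet_T$ is $M$. If $v_1,\ldots,v_p$ are the leaves of $T$, the collection of leaf-to-root morphisms of $\mathcal{F}$ is $\{\mathcal{F}(v_j\to\bullet_T):\mathcal{F}(v_j)\to\mathcal{F}(\bullet_T)\}_{j=1,\ldots,p}$. $\mathcal{S}^{\mathrm{tc}}$ consists of all finite (possibly empty) families $\{\ast\to\ast\}_{i\in I}$ and, for $M\neq\ast$, all multi-morphisms $\{f_j:N_j\to M\}_{j=1,\ldots,p}$ that are the collection of leaf-to-root morphisms of some deletion-contraction tree rooted at $M$ (these are called Tutte coverings of $M$). $\mathcal{S}^{\mathrm{tc}}$ is a covering family structure on $\mathbf{Mat}_+$, and $\mathbf{Mat}^{\mathrm{tc}}=(\mathbf{Mat}_+,\mathcal{S}^{\mathrm{tc}},\ast)$. **$\Gamma$ and $\gamma$.** Every covering family in $\mathcal{S}^{\cong}$ is in $\mathcal{S}^{\mathrm{tc}}$, so the identity functor of $\mathbf{Mat}_+$ underlies a morphism $\Gamma:\mathbf{Mat}^{\cong}\to\mathbf{Mat}^{\mathrm{tc}}$;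 $\gamma:K_0(\mathbf{Mat}^{\cong})\to K_0(\mathbf{Mat}^{\mathrm{tc}})$ is the induced homomorphism. *)

theory Defs
  imports
    "HOL-Algebra.Free_Abelian_Groups"
    "HOL-Computational_Algebra.Polynomial"
    "HOL-Library.Multiset"
    "HOL-Library.Sublist"
begin

section \<open>Matroids\<close>

datatype 'a matroid = Matroid (ground: "'a set") (indep: "'a set set")

definition is_matroid :: "'a matroid \<Rightarrow> bool" where
  "is_matroid M \<longleftrightarrow>
     finite (ground M) \<and> indep M \<subseteq> Pow (ground M) \<and> {} \<in> indep M \<and>
     (\<forall>I\<in>indep M. \<forall>J. J \<subseteq> I \<longrightarrow> J \<in> indep M) \<and>
     (\<forall>I\<in>indep M. \<forall>J\<in>indep M. card J < card I \<longrightarrow> (\<exists>x\<in>I - J. insert x J \<in> indep M))"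

definition is_basis :: "'a matroid \<Rightarrow> 'a set \<Rightarrow> bool" where
  "is_basis M B \<longleftrightarrow> B \<in> indep M \<and> (\<forall>I\<in>indep M. B \<subseteq> I \<longrightarrow> I = B)"

definition is_loop :: "'a matroid \<Rightarrow> 'a \<Rightarrow> bool" where
  "is_loop M e \<longleftrightarrow> e \<in> ground M \<and> {e} \<notin> indep M"

definition is_isthmus :: "'a matroid \<Rightarrow> 'a \<Rightarrow> bool" where
  "is_isthmus M e \<longleftrightarrow> e \<in> ground M \<and> (\<forall>B. is_basis M B \<longrightarrow> e \<in> B)"

definition nondegenerate :: "'a matroid \<Rightarrow> 'a \<Rightarrow> bool" where
  "nondegenerate M e \<longleftrightarrow> e \<in> ground M \<and> \<not> is_loop M e \<and> \<not> is_isthmus M e"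

text \<open>Both operations are total functions here; they are only ever applied where they are
  meaningful: \<open>delete M e\<close> for \<open>e\<close> not an isthmus, \<open>contract M e\<close> for \<open>e\<close> not a loop.\<close>

definition delete :: "'a matroid \<Rightarrow> 'a \<Rightarrow> 'a matroid" where
  "delete M e = Matroid (ground M - {e}) {I. I \<subseteq> ground M - {e} \<and> I \<in> indep M}"

definition contract :: "'a matroid \<Rightarrow> 'a \<Rightarrow> 'a matroid" where
  "contract M e = Matroid (ground M - {e}) {I. I \<subseteq> ground M - {e} \<and> insert e I \<in> indep M}"

definition matroid_isomorphic :: "'a matroid \<Rightarrow> 'b matroid \<Rightarrow> bool" where
  "matroid_isomorphic M N \<longleftrightarrow>
     (\<exists>f. bij_betw f (ground M) (ground N) \<and>
          (\<forall>I. I \<subseteq> ground M \<longrightarrow> (I \<in> indep M \<longleftrightarrow> f ` I \<in> indep N)))"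


section \<open>The Tutte polynomial\<close>

text \<open>\<open>\<int>[x,y]\<close> is realised as \<open>\<int>[x][y]\<close>.\<close>

type_synonym bipoly = "int poly poly"

definition var_x :: bipoly where "var_x = [:[:0, 1:]:]"
definition var_y :: bipoly where "var_y = [:0, 1:]"

definition tutte_recursion :: "('a matroid \<Rightarrow> bipoly) \<Rightarrow> bool" where
  "tutte_recursion T \<longleftrightarrow>
     (\<forall>M N. is_matroid M \<longrightarrow> is_matroid N \<longrightarrow> matroid_isomorphic M N \<longrightarrow> T M = T N) \<and>
     T (Matroid {} {{}}) = 1 \<and>
     (\<forall>M e. is_matroid M \<longrightarrow> nondegenerate M e \<longrightarrow> T M = T (delete M e) + T (contract M e)) \<and>
     (\<forall>M e. is_matroid M \<longrightarrow> is_isthmus M e \<longrightarrow> T M = var_x * T (contract M e)) \<and>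
     (\<forall>M e. is_matroid M \<longrightarrow> is_loop M e \<longrightarrow> T M = var_y * T (delete M e))"

text \<open>The recursion determines the values on matroids (and only those).\<close>

definition tutte :: "'a matroid \<Rightarrow> bipoly" where
  "tutte M = (THE p. \<exists>T. tutte_recursion T \<and> T M = p)"


section \<open>Categories, functors, covering families\<close>

record ('o, 'a) cat =
  Obj :: "'o set"
  Arr :: "'a set"
  Dom :: "'a \<Rightarrow> 'o"
  Cod :: "'a \<Rightarrow> 'o"
  Ident :: "'o \<Rightarrow> 'a"
  Comp :: "'a \<Rightarrow> 'a \<Rightarrow> 'a"  \<comment> \<open>\<open>Comp C g f\<close> is \<open>g\<close> after \<open>f\<close>\<close>

definition is_category :: "('o, 'a, 'z) cat_scheme \<Rightarrow> bool" where
  "is_category C \<longleftrightarrow>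
     (\<forall>f\<in>Arr C. Dom C f \<in> Obj C \<and> Cod C f \<in> Obj C) \<and>
     (\<forall>A\<in>Obj C. Ident C A \<in> Arr C \<and> Dom C (Ident C A) = A \<and> Cod C (Ident C A) = A) \<and>
     (\<forall>f\<in>Arr C. \<forall>g\<in>Arr C. Dom C g = Cod C f \<longrightarrow>
        Comp C g f \<in> Arr C \<and> Dom C (Comp C g f) = Dom C f \<and> Cod C (Comp C g f) = Cod C g) \<and>
     (\<forall>f\<in>Arr C. Comp C f (Ident C (Dom C f)) = f \<and> Comp C (Ident C (Cod C f)) f = f) \<and>
     (\<forall>f\<in>Arr C. \<forall>g\<in>Arr C. \<forall>h\<in>Arr C. Dom C g = Cod C f \<longrightarrow> Dom C h = Cod C g \<longrightarrow>
        Comp C h (Comp C g f) = Comp C (Comp C h g) f)"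

definition iso_arrow :: "('o, 'a, 'z) cat_scheme \<Rightarrow> 'a \<Rightarrow> bool" where
  "iso_arrow C f \<longleftrightarrow> f \<in> Arr C \<and>
     (\<exists>g\<in>Arr C. Dom C g = Cod C f \<and> Cod C g = Dom C f \<and>
        Comp C g f = Ident C (Dom C f) \<and> Comp C f g = Ident C (Cod C f))"

record ('o1, 'a1, 'o2, 'a2) cat_functor =
  OMap :: "'o1 \<Rightarrow> 'o2"
  AMap :: "'a1 \<Rightarrow> 'a2"

definition is_functor ::
  "('o1, 'a1, 'z1) cat_scheme \<Rightarrow> ('o2, 'a2, 'z2) cat_scheme \<Rightarrow> ('o1, 'a1, 'o2, 'a2) cat_functor \<Rightarrow> bool"
where
  "is_functor C D F \<longleftrightarrow>
     (\<forall>A\<in>Obj C. OMap F A \<in> Obj D \<and> AMap F (Ident C A) = Ident D (OMap F A)) \<and>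
     (\<forall>f\<in>Arr C. AMap F f \<in> Arr D \<and>
        Dom D (AMap F f) = OMap F (Dom C f) \<and> Cod D (AMap F f) = OMap F (Cod C f)) \<and>
     (\<forall>f\<in>Arr C. \<forall>g\<in>Arr C. Dom C g = Cod C f \<longrightarrow>
        AMap F (Comp C g f) = Comp D (AMap F g) (AMap F f))"

definition naturally_isomorphic ::
  "('o1, 'a1, 'z1) cat_scheme \<Rightarrow> ('o2, 'a2, 'z2) cat_scheme \<Rightarrow>
   ('o1, 'a1, 'o2, 'a2) cat_functor \<Rightarrow> ('o1, 'a1, 'o2, 'a2) cat_functor \<Rightarrow> bool"
where
  "naturally_isomorphic C D F G \<longleftrightarrow>
     (\<exists>\<eta>. (\<forall>A\<in>Obj C. iso_arrow D (\<eta> A) \<and> Dom D (\<eta> A) = OMap F A \<and> Cod D (\<eta> A) = OMap G A) \<and>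
          (\<forall>f\<in>Arr C. Comp D (\<eta> (Cod C f)) (AMap F f) = Comp D (AMap G f) (\<eta> (Dom C f))))"

text \<open>A multi-morphism is a target together with a finite multiset of arrows into it.
  The target is recorded because it cannot be recovered from an empty family.\<close>

record ('o, 'a) covcat = "('o, 'a) cat" +
  Base :: 'o
  Covers :: "('o \<times> 'a multiset) set"

text \<open>In the last clause below, the multiset \<open>P\<close> of pairs \<open>(g, Q)\<close> is the family of all
  \<open>g\<^sub>j\<close>, each paired with a covering family \<open>Q = {f\<^sub>i\<^sub>j}\<close> of its source.\<close>

definition category_with_covering_families :: "('o, 'a, 'z) covcat_scheme \<Rightarrow> bool" where
  "category_with_covering_families C \<longleftrightarrow>
     is_category C \<and> Base C \<in> Obj C \<and>
     (\<forall>f\<in>Arr C. Cod C f = Base C \<longrightarrow> f = Ident C (Base C)) \<and>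
     (\<forall>(B, Q)\<in>Covers C. B \<in> Obj C \<and> (\<forall>f\<in>#Q. f \<in> Arr C \<and> Cod C f = B)) \<and>
     (\<forall>n. (Base C, replicate_mset n (Ident C (Base C))) \<in> Covers C) \<and>
     (\<forall>A\<in>Obj C. (A, {#Ident C A#}) \<in> Covers C) \<and>
     (\<forall>B P. (B, image_mset fst P) \<in> Covers C \<longrightarrow>
        (\<forall>(g, Q)\<in>#P. (Dom C g, Q) \<in> Covers C) \<longrightarrow>
        (B, \<Sum>(g, Q)\<in>#P. image_mset (Comp C g) Q) \<in> Covers C)"

definition covering_morphism ::
  "('o1, 'a1, 'z1) covcat_scheme \<Rightarrow> ('o2, 'a2, 'z2) covcat_scheme \<Rightarrow>
   ('o1, 'a1, 'o2, 'a2) cat_functor \<Rightarrow> bool"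
where
  "covering_morphism C D F \<longleftrightarrow>
     is_functor C D F \<and> OMap F (Base C) = Base D \<and>
     (\<forall>(B, Q)\<in>Covers C. (OMap F B, image_mset (AMap F) Q) \<in> Covers D)"


section \<open>The group \<open>K\<^sub>0\<close>\<close>

definition K0_relations :: "('o, 'a, 'z) covcat_scheme \<Rightarrow> ('o \<Rightarrow>\<^sub>0 int) set" where
  "K0_relations C = generate (free_Abelian_group (Obj C))
     {frag_of B - (\<Sum>f\<in>#Q. frag_of (Dom C f)) | B Q. (B, Q) \<in> Covers C}"

definition K0 :: "('o, 'a, 'z) covcat_scheme \<Rightarrow> ('o \<Rightarrow>\<^sub>0 int) set monoid" where
  "K0 C = free_Abelian_group (Obj C) Mod K0_relations C"

definition K0_coset :: "('o, 'a, 'z) covcat_scheme \<Rightarrow> ('o \<Rightarrow>\<^sub>0 int) \<Rightarrow> ('o \<Rightarrow>\<^sub>0 int) set" where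
  "K0_coset C c = K0_relations C #>\<^bsub>free_Abelian_group (Obj C)\<^esub> c"

text \<open>The homomorphism induced by \<open>F\<close>, i.e. \<open>[A] \<mapsto> [F A]\<close>: for a morphism \<open>F\<close> all the cosets in
  the union coincide.\<close>

definition K0_map ::
  "('o1, 'a1, 'z1) covcat_scheme \<Rightarrow> ('o2, 'a2, 'z2) covcat_scheme \<Rightarrow>
   ('o1, 'a1, 'o2, 'a2) cat_functor \<Rightarrow> ('o1 \<Rightarrow>\<^sub>0 int) set \<Rightarrow> ('o2 \<Rightarrow>\<^sub>0 int) set"
where
  "K0_map C D F X = (\<Union>c\<in>X. K0_coset D (frag_extend (\<lambda>A. frag_of (OMap F A)) c))"


section \<open>The category of matroids\<close>

definition Mat_objects :: "nat matroid set" where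
  "Mat_objects = {M. is_matroid M \<and> ground M \<subseteq> {1..}}"

text \<open>Maps between ground sets are made extensional, so that equal morphisms are equal functions.\<close>

definition Mat_hom :: "nat matroid \<Rightarrow> nat matroid \<Rightarrow> (nat \<Rightarrow> nat) set" where
  "Mat_hom M N = {f \<in> ground M \<rightarrow>\<^sub>E ground N. inj_on f (ground M) \<and> (\<forall>I\<in>indep M. f ` I \<in> indep N)}"

text \<open>The added base-point is \<open>None\<close>, with empty underlying set.\<close>

fun pground :: "nat matroid option \<Rightarrow> nat set" where
  "pground None = {}"
| "pground (Some M) = ground M"

fun Mat_plus_hom :: "nat matroid option \<Rightarrow> nat matroid option \<Rightarrow> (nat \<Rightarrow> nat) set" where
  "Mat_plus_hom None None = {\<lambda>_. undefined}"
| "Mat_plus_hom (Some M) (Some N) = Mat_hom M N"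
| "Mat_plus_hom None (Some N) = {}"
| "Mat_plus_hom (Some M) None = {}"

text \<open>A morphism is a triple: source, underlying map, target.\<close>

type_synonym mat_arrow = "nat matroid option \<times> (nat \<Rightarrow> nat) \<times> nat matroid option"

definition inclusion :: "nat matroid \<Rightarrow> nat matroid \<Rightarrow> mat_arrow" where
  "inclusion M N = (Some M, \<lambda>x\<in>ground M. x, Some N)"

definition Mat_plus :: "(nat matroid option, mat_arrow) cat" where
  "Mat_plus =
     \<lparr>Obj = insert None (Some ` Mat_objects),
      Arr = {(A, f, B). A \<in> insert None (Some ` Mat_objects) \<and> B \<in> insert None (Some ` Mat_objects) \<and>
                        f \<in> Mat_plus_hom A B},
      Dom = (\<lambda>(A, f, B). A),
      Cod = (\<lambda>(A, f, B). B),
      Ident = (\<lambda>A. (A, \<lambda>x\<in>pground A. x, A)),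
      Comp = (\<lambda>(B, g, D) (A, f, B'). (A, compose (pground A) g f, D))\<rparr>"

definition base_covers :: "(nat matroid option \<times> mat_arrow multiset) set" where
  "base_covers = {(None, replicate_mset n (Ident Mat_plus None)) | n. True}"

definition iso_covers :: "(nat matroid option \<times> mat_arrow multiset) set" where
  "iso_covers = base_covers \<union> {(Cod Mat_plus f, {#f#}) | f. iso_arrow Mat_plus f}"

definition Mat_iso :: "(nat matroid option, mat_arrow) covcat" where
  "Mat_iso = cat.extend Mat_plus \<lparr>Base = None, Covers = iso_covers\<rparr>"


section \<open>Deletion-contraction trees\<close>

text \<open>A vertex of a rooted binary tree is the word of left/right turns leading to it from the root
  \<open>[]\<close>; a tree is the set of its vertices.\<close>

type_synonym vertex = "bool list"

definition rooted_binary_tree :: "vertex set \<Rightarrow> bool" where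
  "rooted_binary_tree T \<longleftrightarrow> finite T \<and> [] \<in> T \<and> (\<forall>v b. v @ [b] \<in> T \<longrightarrow> v \<in> T)"

definition children :: "vertex set \<Rightarrow> vertex \<Rightarrow> vertex set" where
  "children T v = {v @ [b] | b. v @ [b] \<in> T}"

definition leaves :: "vertex set \<Rightarrow> vertex set" where
  "leaves T = {v \<in> T. children T v = {}}"

text \<open>The poset category: there is one arrow \<open>(w, v)\<close>, from \<open>w\<close> to \<open>v\<close>, whenever \<open>w\<close> is \<open>v\<close> or a
  descendant of \<open>v\<close>.\<close>

definition tree_cat :: "vertex set \<Rightarrow> (vertex, vertex \<times> vertex) cat" where
  "tree_cat T =
     \<lparr>Obj = T, Arr = {(w, v). w \<in> T \<and> v \<in> T \<and> prefix v w}, Dom = fst, Cod = snd,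
      Ident = (\<lambda>v. (v, v)), Comp = (\<lambda>g f. (fst f, snd g))\<rparr>"

type_synonym tree_functor = "(vertex, vertex \<times> vertex, nat matroid option, mat_arrow) cat_functor"

definition elementary_dc_tree :: "vertex set \<Rightarrow> tree_functor \<Rightarrow> bool" where
  "elementary_dc_tree T F \<longleftrightarrow>
     is_functor (tree_cat T) Mat_plus F \<and>
     OMap F [] \<noteq> None \<and>
     (\<forall>v\<in>T. \<forall>w. children T v = {w} \<longrightarrow>
        OMap F w = OMap F v \<and> AMap F (w, v) = Ident Mat_plus (OMap F v)) \<and>
     (\<forall>v\<in>T. \<forall>w1 w2. w1 \<noteq> w2 \<longrightarrow> children T v = {w1, w2} \<longrightarrow>
        (\<exists>N N1 N2 e. OMap F v = Some N \<and> OMap F w1 = Some N1 \<and> OMap F w2 = Some N2 \<and>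
           nondegenerate N e \<and>
           (N1 = contract N e \<and> N2 = delete N e \<or> N1 = delete N e \<and> N2 = contract N e) \<and>
           AMap F (w1, v) = inclusion N1 N \<and> AMap F (w2, v) = inclusion N2 N))"

definition dc_tree :: "vertex set \<Rightarrow> tree_functor \<Rightarrow> bool" where
  "dc_tree T F \<longleftrightarrow> is_functor (tree_cat T) Mat_plus F \<and>
     (\<exists>G. elementary_dc_tree T G \<and> naturally_isomorphic (tree_cat T) Mat_plus F G)"

definition leaf_to_root :: "vertex set \<Rightarrow> tree_functor \<Rightarrow> mat_arrow multiset" where
  "leaf_to_root T F = image_mset (\<lambda>v. AMap F (v, [])) (mset_set (leaves T))"

definition tutte_covers :: "(nat matroid option \<times> mat_arrow multiset) set" where
  "tutte_covers = base_covers \<union>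
     {(Some M, leaf_to_root T F) | M T F.
        M \<in> Mat_objects \<and> rooted_binary_tree T \<and> dc_tree T F \<and> OMap F [] = Some M}"

definition Mat_tc :: "(nat matroid option, mat_arrow) covcat" where
  "Mat_tc = cat.extend Mat_plus \<lparr>Base = None, Covers = tutte_covers\<rparr>"

definition Gamma :: "(nat matroid option, mat_arrow, nat matroid option, mat_arrow) cat_functor" where
  "Gamma = \<lparr>OMap = (\<lambda>A. A), AMap = (\<lambda>f. f)\<rparr>"

definition gamma :: "(nat matroid option \<Rightarrow>\<^sub>0 int) set \<Rightarrow> (nat matroid option \<Rightarrow>\<^sub>0 int) set" where
  "gamma = K0_map Mat_iso Mat_tc Gamma"


section \<open>The groups \<open>\<int>[\<M>]\<close> and \<open>\<int>[x,y]\<close>\<close>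

text \<open>Every matroid is isomorphic to one with ground set in \<open>{1,2,\<dots>}\<close>, so the isomorphism classes
  can be taken within the objects of the category.\<close>

definition iso_class :: "nat matroid \<Rightarrow> nat matroid set" where
  "iso_class M = {N \<in> Mat_objects. matroid_isomorphic M N}"

definition matroid_classes :: "nat matroid set set" where
  "matroid_classes = iso_class ` Mat_objects"

abbreviation Z_classes :: "(nat matroid set \<Rightarrow>\<^sub>0 int) monoid" where
  "Z_classes \<equiv> free_Abelian_group matroid_classes"

definition Z_xy :: "bipoly monoid" where
  "Z_xy = \<lparr>carrier = UNIV, monoid.mult = (+), one = 0\<rparr>"

text \<open>The identification of \<open>K\<^sub>0\<close> of \<^const>\<open>Mat_iso\<close> with \<open>\<int>[\<M>]\<close>: the class of a matroid goes to its
  isomorphism class, the class of the base-point to \<open>0\<close>. All representatives of a coset have the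
  same image.\<close>

definition class_of_object :: "nat matroid option \<Rightarrow> (nat matroid set \<Rightarrow>\<^sub>0 int)" where
  "class_of_object A = (case A of None \<Rightarrow> 0 | Some M \<Rightarrow> frag_of (iso_class M))"

definition K0_Mat_iso_ident :: "(nat matroid option \<Rightarrow>\<^sub>0 int) set \<Rightarrow> (nat matroid set \<Rightarrow>\<^sub>0 int)" where
  "K0_Mat_iso_ident X = the_elem (frag_extend class_of_object ` X)"

text \<open>The \<open>\<int>\<close>-linear extension of \<open>[M] \<mapsto> T(M;x,y)\<close>.\<close>

definition tutte_hom :: "(nat matroid set \<Rightarrow>\<^sub>0 int) \<Rightarrow> bipoly" where
  "tutte_hom c = (\<Sum>K\<in>Poly_Mapping.keys c. of_int (Poly_Mapping.lookup c K) * the_elem (tutte ` K))"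

end

theory Submission
  imports Defs
begin

text \<open>The corank-nullity expansion solves the recursion of the Tutte polynomial \<open>T\<close>, and it is additive
  along deletion-contraction trees, so the linear extension \<open>h\<close> of \<open>T\<close> kills the relations of
  \<open>K\<^sub>0\<close>. Conversely, let \<open>s\<close> send \<open>x\<^sup>i y\<^sup>j\<close> to the matroid with \<open>i\<close> isthmuses and \<open>j\<close> loops, so that
  \<open>h \<circ> s = id\<close>. By induction on the ground set every matroid \<open>M\<close> is congruent to \<open>s (T M)\<close>: expand along a
  non-degenerate element, and if there is none, \<open>M\<close> is isomorphic to some \<open>s (x\<^sup>i y\<^sup>j)\<close>. Hence the
  relations are exactly the kernel of \<open>h\<close>. Uniqueness of \<open>\<rho>\<close> holds because \<open>gamma\<close> is surjective.\<close>

section \<open>Matroids and rank\<close>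

text \<open>\<open>tutte\<close> is a definite description over all solutions of the recursion, so
  nothing can be computed with it before a solution is exhibited. Taking the recursion itself as a
  construction would call for a proof that the result does not depend on the chosen elements; a
  closed formula turns each clause into a statement about the rank function. The two inclusions
  between relations and kernel use the coverings differently. That h kills the relations concerns
  arbitrary trees, and only up to natural isomorphism, so it needs an induction over vertices and
  the isomorphism invariance of T. The converse needs only three kinds of coverings: the empty
  family at the base-point, a single isomorphism, and one deletion-contraction pair. The last two
  come from trees of height one. Once the relations are known to be the kernel, every coset in
  \<open>K0 Mat_tc\<close> is a fibre of h. The unions and \<open>the_elem\<close> in the
  definitions of \<open>gamma\<close> and of the identifications can then be evaluated on any
  representative.\<close>

lemma matroid_finite_ground: "is_matroid M \<Longrightarrow> finite (ground M)"
  by (simp add: is_matroid_def)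

lemma matroid_indep_ground: "is_matroid M \<Longrightarrow> I \<in> indep M \<Longrightarrow> I \<subseteq> ground M"
  by (auto simp: is_matroid_def)

lemma matroid_indep_finite: "is_matroid M \<Longrightarrow> I \<in> indep M \<Longrightarrow> finite I"
  by (meson matroid_finite_ground matroid_indep_ground finite_subset)

lemma matroid_indep_empty: "is_matroid M \<Longrightarrow> {} \<in> indep M"
  by (simp add: is_matroid_def)

lemma matroid_indep_subset: "is_matroid M \<Longrightarrow> I \<in> indep M \<Longrightarrow> J \<subseteq> I \<Longrightarrow> J \<in> indep M"
  by (auto simp: is_matroid_def)

lemma matroid_augment1:
  "is_matroid M \<Longrightarrow> I \<in> indep M \<Longrightarrow> J \<in> indep M \<Longrightarrow> card J < card I \<Longrightarrow>
   \<exists>x\<in>I - J. insert x J \<in> indep M"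
  unfolding is_matroid_def by blast

lemma matroid_finite_indep: "is_matroid M \<Longrightarrow> finite (indep M)"
  by (meson finite_Pow_iff finite_subset is_matroid_def)

text \<open>Iterated exchange, by induction on the gap between the two sizes. Its use is to force a
  prescribed element into an independent set without changing the size of that set.\<close>

lemma matroid_augment:
  assumes M: "is_matroid M" and I: "I \<in> indep M" and J: "J \<in> indep M" and "card J \<le> card I"
  obtains K where "K \<in> indep M" "J \<subseteq> K" "K \<subseteq> J \<union> I" "card K = card I"
proof -
  have "\<exists>K\<in>indep M. J \<subseteq> K \<and> K \<subseteq> J \<union> I \<and> card K = card I"
    using J \<open>card J \<le> card I\<close>
  proof (induction "card I - card J" arbitrary: J)
    case 0
    then show ?case by auto
  next
    case (Suc n)
    then have "card J < card I" by simp
    then obtain x where x: "x \<in> I - J" "insert x J \<in> indep M"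
      using matroid_augment1[OF M I] Suc.prems by blast
    have "card (insert x J) = Suc (card J)"
      using x matroid_indep_finite[OF M] Suc.prems(1) by simp
    then have "\<exists>K\<in>indep M. insert x J \<subseteq> K \<and> K \<subseteq> insert x J \<union> I \<and> card K = card I"
      using Suc.hyps(1)[of "insert x J"] Suc.hyps(2) x(2) by simp
    then show ?case using x by blast
  qed
  with that show thesis by blast
qed

lemma basis_extends:
  assumes "is_matroid M" "I \<in> indep M"
  obtains B where "is_basis M B" "I \<subseteq> B"
proof -
  obtain B where "B \<in> indep M" "I \<subseteq> B" "\<forall>J\<in>indep M. B \<subseteq> J \<longrightarrow> J = B"
    using finite_has_maximal2[OF matroid_finite_indep] assms by (metis order_refl)
  then show thesis using that by (auto simp: is_basis_def)
qed

lemma basis_card_max: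
  assumes "is_matroid M" "is_basis M B" "I \<in> indep M"
  shows "card I \<le> card B"
proof (rule ccontr)
  assume "\<not> card I \<le> card B"
  then obtain x where "x \<in> I - B" "insert x B \<in> indep M"
    using matroid_augment1[of M I B] assms by (auto simp: is_basis_def)
  then show False using assms(2) by (auto simp: is_basis_def)
qed

definition mrank :: "'a matroid \<Rightarrow> 'a set \<Rightarrow> nat" where
  "mrank M A = Max (card ` {I \<in> indep M. I \<subseteq> A})"

lemma mrank_eqI:
  assumes "is_matroid M" "I \<in> indep M" "I \<subseteq> A"
    and "\<And>J. J \<in> indep M \<Longrightarrow> J \<subseteq> A \<Longrightarrow> card J \<le> card I"
  shows "mrank M A = card I"
  unfolding mrank_def using assms matroid_finite_indep[of M] by (intro Max_eqI) auto

lemma mrank_ge: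
  assumes "is_matroid M" "I \<in> indep M" "I \<subseteq> A"
  shows "card I \<le> mrank M A"
  unfolding mrank_def using assms matroid_finite_indep[of M] by (intro Max_ge) auto

lemma mrank_obtain:
  assumes "is_matroid M"
  obtains I where "I \<in> indep M" "I \<subseteq> A" "card I = mrank M A"
proof -
  have "mrank M A \<in> card ` {I \<in> indep M. I \<subseteq> A}"
    unfolding mrank_def using assms matroid_finite_indep[of M] matroid_indep_empty[of M]
    by (intro Max_in) auto
  then show thesis using that by auto
qed

lemma mrank_le_card:
  assumes "is_matroid M" "finite A"
  shows "mrank M A \<le> card A"
proof -
  obtain I where "I \<subseteq> A" "card I = mrank M A" using mrank_obtain[OF assms(1)] .
  then show ?thesis using card_mono[OF assms(2)] by metis
qed

lemma mrank_mono:
  assumes "is_matroid M" "A \<subseteq> B"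
  shows "mrank M A \<le> mrank M B"
proof -
  obtain I where I: "I \<in> indep M" "I \<subseteq> A" "card I = mrank M A" using mrank_obtain[OF assms(1)] .
  then show ?thesis using mrank_ge[OF assms(1) I(1), of B] assms(2) by auto
qed

section \<open>Deletion, contraction, isthmuses, loops, and their effect on rank\<close>

lemma ground_delete [simp]: "ground (delete M e) = ground M - {e}"
  and ground_contract [simp]: "ground (contract M e) = ground M - {e}"
  and indep_delete: "I \<in> indep (delete M e) \<longleftrightarrow> I \<subseteq> ground M - {e} \<and> I \<in> indep M"
  and indep_contract: "I \<in> indep (contract M e) \<longleftrightarrow> I \<subseteq> ground M - {e} \<and> insert e I \<in> indep M"
  by (simp_all add: delete_def contract_def)

lemma is_matroid_delete:
  assumes M: "is_matroid M"
  shows "is_matroid (delete M e)"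
proof -
  have "\<exists>x\<in>I - J. insert x J \<in> indep (delete M e)"
    if "I \<in> indep (delete M e)" "J \<in> indep (delete M e)" "card J < card I" for I J
    using matroid_augment1[OF M, of I J] that by (auto simp: indep_delete)
  moreover have "J \<in> indep (delete M e)" if "I \<in> indep (delete M e)" "J \<subseteq> I" for I J
    using that matroid_indep_subset[OF M, of I J] by (auto simp: indep_delete)
  moreover have "indep (delete M e) \<subseteq> Pow (ground (delete M e))" "{} \<in> indep (delete M e)"
    using matroid_indep_empty[OF M] by (auto simp: indep_delete)
  ultimately show ?thesis
    using matroid_finite_ground[OF M] unfolding is_matroid_def by auto
qed

lemma is_matroid_contract:
  assumes M: "is_matroid M" and "{e} \<in> indep M"
  shows "is_matroid (contract M e)"
proof -
  have "\<exists>x\<in>I - J. insert x J \<in> indep (contract M e)"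
    if IJ: "I \<in> indep (contract M e)" "J \<in> indep (contract M e)" "card J < card I" for I J
  proof -
    have fin: "finite I" "finite J"
      using that matroid_finite_ground[OF M] by (auto simp: indep_contract intro: finite_subset)
    have e: "e \<notin> I" "e \<notin> J" using that by (auto simp: indep_contract)
    have "card (insert e J) < card (insert e I)" using that(3) fin e by simp
    \<comment> \<open>Exchange in \<open>M\<close> between the two sets enlarged by
      \<open>e\<close>; the element found differs from \<open>e\<close>, since \<open>e\<close>
      already lies in the smaller set.\<close>
    then obtain x where "x \<in> insert e I - insert e J" "insert x (insert e J) \<in> indep M"
      using matroid_augment1[OF M] IJ(1,2) unfolding indep_contract by metis
    then show ?thesis using that by (auto simp: indep_contract insert_commute)
  qed
  moreover have "J \<in> indep (contract M e)" if "I \<in> indep (contract M e)" "J \<subseteq> I" for I J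
    using that matroid_indep_subset[OF M, of "insert e I" "insert e J"] by (auto simp: indep_contract)
  moreover have "indep (contract M e) \<subseteq> Pow (ground (contract M e))"
    by (auto simp: indep_contract)
  moreover have "{} \<in> indep (contract M e)"
    using assms by (auto simp: indep_contract)
  ultimately show ?thesis
    using matroid_finite_ground[OF M] unfolding is_matroid_def by auto
qed

lemma mrank_delete:
  assumes M: "is_matroid M" and A: "A \<subseteq> ground M - {e}"
  shows "mrank (delete M e) A = mrank M A"
proof -
  obtain I where "I \<in> indep M" "I \<subseteq> A" "card I = mrank M A"
    using mrank_obtain[OF M] .
  then show ?thesis
    using mrank_eqI[OF is_matroid_delete[OF M], of I e A] mrank_ge[OF M, of _ A] A
    by (auto simp: indep_delete)
qed

text \<open>Adding \<open>e\<close> to a largest independent subset of \<open>A\<close> in the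
  contraction is optimal: an independent competitor in \<open>insert e A\<close> can be exchanged
  for one of equal size that contains \<open>e\<close>, and removing \<open>e\<close> from it gives
  an independent set of the contraction.\<close>

lemma mrank_contract:
  assumes M: "is_matroid M" and e: "{e} \<in> indep M" and A: "A \<subseteq> ground M - {e}"
  shows "mrank M (insert e A) = Suc (mrank (contract M e) A)"
proof -
  note Mc = is_matroid_contract[OF M e]
  obtain I where I: "I \<in> indep (contract M e)" "I \<subseteq> A" "card I = mrank (contract M e) A"
    using mrank_obtain[OF Mc] .
  have eI: "e \<notin> I" using I A by auto
  have cI: "card (insert e I) = Suc (card I)"
    using eI matroid_indep_finite[OF Mc I(1)] by simp
  have "mrank M (insert e A) = card (insert e I)"
  proof (rule mrank_eqI[OF M])
    show "insert e I \<in> indep M" "insert e I \<subseteq> insert e A"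
      using I by (auto simp: indep_contract)
    fix J assume J: "J \<in> indep M" "J \<subseteq> insert e A"
    show "card J \<le> card (insert e I)"
    \<comment> \<open>Exchange starting from \<open>{e}\<close> needs a competitor with at least one
      element; the empty one is trivially small enough.\<close>
    proof (cases "card J = 0")
      case False
      then have "card {e} \<le> card J" by simp
      then obtain K where K: "K \<in> indep M" "{e} \<subseteq> K" "K \<subseteq> {e} \<union> J" "card K = card J"
        using matroid_augment[OF M J(1) e] by metis
      have "K - {e} \<in> indep (contract M e)" "K - {e} \<subseteq> A"
        using K J(2) matroid_indep_ground[OF M K(1)] by (auto simp: indep_contract insert_absorb)
      then have "card (K - {e}) \<le> card I" using mrank_ge[OF Mc] I(3) by metis
      then show ?thesis using cI K(2,4) matroid_indep_finite[OF M K(1)]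
        by (simp add: card_Diff_singleton)
    qed simp
  qed
  then show ?thesis using cI I(3) by simp
qed

text \<open>Extend the independent set to a basis; that basis contains \<open>e\<close>.\<close>

lemma indep_insert_isthmus:
  assumes "is_matroid M" "is_isthmus M e" "I \<in> indep M"
  shows "insert e I \<in> indep M"
proof -
  obtain B where "is_basis M B" "I \<subseteq> B" using basis_extends assms by metis
  then show ?thesis
    using assms(2) matroid_indep_subset[OF assms(1), of B "insert e I"]
    by (auto simp: is_basis_def is_isthmus_def)
qed

lemma indep_not_loop: "is_matroid M \<Longrightarrow> is_loop M e \<Longrightarrow> I \<in> indep M \<Longrightarrow> e \<notin> I"
  using matroid_indep_subset[of M I "{e}"] by (auto simp: is_loop_def)

lemma mrank_insert_isthmus:
  assumes M: "is_matroid M" and e: "is_isthmus M e" and A: "A \<subseteq> ground M - {e}"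
  shows "mrank M (insert e A) = Suc (mrank M A)"
proof -
  obtain I where I: "I \<in> indep M" "I \<subseteq> A" "card I = mrank M A"
    using mrank_obtain[OF M] .
  have "e \<notin> I" using I(2) A by auto
  then have cI: "card (insert e I) = Suc (card I)"
    using matroid_indep_finite[OF M I(1)] by simp
  have "mrank M (insert e A) = card (insert e I)"
  proof (rule mrank_eqI[OF M])
    show "insert e I \<in> indep M" using indep_insert_isthmus[OF M e I(1)] .
    show "insert e I \<subseteq> insert e A" using I by auto
    fix J assume J: "J \<in> indep M" "J \<subseteq> insert e A"
    have "card (J - {e}) \<le> card I"
      using mrank_ge[OF M, of "J - {e}" A] J I(3) matroid_indep_subset[OF M J(1)] by auto
    then show "card J \<le> card (insert e I)"
      using cI card_Diff1_le[of J e] matroid_indep_finite[OF M J(1)]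
      by (cases "e \<in> J") (auto simp: card_Diff_singleton)
  qed
  then show ?thesis using cI I(3) by simp
qed

lemma mrank_insert_loop:
  assumes M: "is_matroid M" and e: "is_loop M e"
  shows "mrank M (insert e A) = mrank M A"
proof -
  have "{I \<in> indep M. I \<subseteq> insert e A} = {I \<in> indep M. I \<subseteq> A}"
    using indep_not_loop[OF M e] by auto
  then show ?thesis by (simp add: mrank_def)
qed

text \<open>Some basis avoids \<open>e\<close>, and it is a largest independent set both in the
  ground set and in the ground set without \<open>e\<close>.\<close>

lemma mrank_ground_not_isthmus:
  assumes M: "is_matroid M" and e: "e \<in> ground M" "\<not> is_isthmus M e"
  shows "mrank M (ground M - {e}) = mrank M (ground M)"
proof -
  obtain B where B: "is_basis M B" "e \<notin> B" using e by (auto simp: is_isthmus_def)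
  then have I: "B \<in> indep M" by (simp add: is_basis_def)
  have "mrank M A = card B" if "B \<subseteq> A" for A
    using mrank_eqI[OF M I that] basis_card_max[OF M B(1)] by blast
  moreover have "B \<subseteq> ground M" "B \<subseteq> ground M - {e}"
    using matroid_indep_ground[OF M I] B(2) by auto
  ultimately show ?thesis by metis
qed

text \<open>Taking images matches the independent subsets of \<open>A\<close> with those of its
  image and preserves cardinality, so both maxima are over the same set of numbers.\<close>

lemma mrank_image:
  assumes M: "is_matroid M" and f: "inj_on f (ground M)"
    and fI: "\<And>I. I \<subseteq> ground M \<Longrightarrow> I \<in> indep M \<longleftrightarrow> f ` I \<in> indep N"
    and A: "A \<subseteq> ground M"
  shows "mrank N (f ` A) = mrank M A"
proof -
  have "{J \<in> indep N. J \<subseteq> f ` A} = (`) f ` {I \<in> indep M. I \<subseteq> A}"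
    using A fI by (auto simp: subset_image_iff intro: subset_trans)
  moreover have "card (f ` I) = card I" if "I \<subseteq> A" for I
    using that f A by (meson card_image inj_on_subset)
  ultimately show ?thesis by (auto simp: mrank_def image_image intro!: arg_cong[where f = Max] image_cong)
qed

section \<open>The Tutte polynomial\<close>

text \<open>Whitney's rank generating function in the shifted variables x - 1 and y - 1. For
  \<open>A\<close> inside the ground set of a matroid the subtractions of naturals do not truncate,
  by \<open>mrank_mono\<close> and \<open>mrank_le_card\<close>.\<close>

definition corank_nullity :: "'a matroid \<Rightarrow> bipoly" where
  "corank_nullity M = (\<Sum>A\<in>Pow (ground M).
     (var_x - 1) ^ (mrank M (ground M) - mrank M A) * (var_y - 1) ^ (card A - mrank M A))"

lemma sum_Pow_insert:
  assumes "finite E" "e \<notin> E"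
  shows "(\<Sum>A\<in>Pow (insert e E). f A :: 'b::comm_monoid_add) =
         (\<Sum>A\<in>Pow E. f A) + (\<Sum>A\<in>Pow E. f (insert e A))"
proof -
  have "inj_on (insert e) (Pow E)" "Pow E \<inter> insert e ` Pow E = {}"
    using assms by (auto simp: inj_on_def)
  then show ?thesis
    using assms by (simp add: Pow_insert sum.union_disjoint sum.reindex)
qed

text \<open>Common start of the three recursion clauses: each subset \<open>A\<close> avoiding
  \<open>e\<close> is paired with \<open>insert e A\<close>, so that the clauses can be compared
  summand by summand.\<close>

lemma corank_nullity_insert:
  assumes M: "is_matroid M" and E: "ground M = insert e E" "e \<notin> E"
  shows "corank_nullity M = (\<Sum>A\<in>Pow E.
     (var_x - 1) ^ (mrank M (insert e E) - mrank M A) * (var_y - 1) ^ (card A - mrank M A) +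
     (var_x - 1) ^ (mrank M (insert e E) - mrank M (insert e A)) *
     (var_y - 1) ^ (Suc (card A) - mrank M (insert e A)))"
proof -
  have "finite E" using matroid_finite_ground[OF M] E by simp
  moreover have "card (insert e A) = Suc (card A)" if "A \<in> Pow E" for A
    using that \<open>finite E\<close> E(2) by (subst card_insert_disjoint) (auto intro: finite_subset)
  ultimately show ?thesis
    using E by (simp add: corank_nullity_def sum_Pow_insert sum.distrib)
qed

text \<open>The subsets avoiding \<open>e\<close> give the deletion, because removing
  \<open>e\<close> keeps the total rank. The subsets containing \<open>e\<close> give the
  contraction, because their rank, their size and the total rank all drop by one.\<close>

lemma corank_nullity_nondegenerate:
  assumes M: "is_matroid M" and e: "nondegenerate M e"
  shows "corank_nullity M = corank_nullity (delete M e) + corank_nullity (contract M e)"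
proof -
  have eg: "e \<in> ground M" "{e} \<in> indep M" "\<not> is_isthmus M e"
    using e by (auto simp: nondegenerate_def is_loop_def)
  then obtain E where E: "ground M = insert e E" "e \<notin> E" by (meson mk_disjoint_insert)
  then have E': "ground M - {e} = E" by simp
  have rE: "mrank M (insert e E) = mrank M E"
    using mrank_ground_not_isthmus[OF M eg(1,3)] E by simp
  have cE: "mrank M (insert e A) = Suc (mrank (contract M e) A)" if "A \<subseteq> E" for A
    using mrank_contract[OF M eg(2)] that by (simp add: E')
  have dE: "mrank (delete M e) A = mrank M A" if "A \<subseteq> E" for A
    using mrank_delete[OF M] that by (simp add: E')
  have rE': "mrank M E = Suc (mrank (contract M e) E)"
    using rE cE by simp
  have "corank_nullity M = (\<Sum>A\<in>Pow E.
     (var_x - 1) ^ (mrank (delete M e) E - mrank (delete M e) A) *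
     (var_y - 1) ^ (card A - mrank (delete M e) A) +
     (var_x - 1) ^ (mrank (contract M e) E - mrank (contract M e) A) *
     (var_y - 1) ^ (card A - mrank (contract M e) A))"
    unfolding corank_nullity_insert[OF M E] rE
    by (intro sum.cong) (simp_all add: cE dE rE')
  then show ?thesis
    by (simp add: corank_nullity_def E' sum.distrib)
qed

text \<open>Of the pair \<open>A\<close>, \<open>insert e A\<close>, both have the same nullity and
  the first has corank larger by one, so the pair contributes the factor (x - 1) + 1 = x.\<close>

lemma corank_nullity_isthmus:
  assumes M: "is_matroid M" and e: "is_isthmus M e"
  shows "corank_nullity M = var_x * corank_nullity (contract M e)"
proof -
  have eg: "e \<in> ground M" "{e} \<in> indep M"
    using e indep_insert_isthmus[OF M e matroid_indep_empty[OF M]] by (auto simp: is_isthmus_def)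
  then obtain E where E: "ground M = insert e E" "e \<notin> E" by (meson mk_disjoint_insert)
  then have E': "ground M - {e} = E" by simp
  have iE: "mrank M (insert e A) = Suc (mrank M A)" if "A \<subseteq> E" for A
    using mrank_insert_isthmus[OF M e] that by (simp add: E')
  have cE: "mrank (contract M e) A = mrank M A" if "A \<subseteq> E" for A
    using mrank_contract[OF M eg(2), of A] iE[of A] that by (simp add: E')
  \<comment> \<open>\<open>Suc\<close> may be pulled out of the natural subtraction only because the
    rank of \<open>A\<close> is at most that of \<open>E\<close>.\<close>
  have mono: "Suc (mrank M E) - mrank M A = Suc (mrank M E - mrank M A)" if "A \<subseteq> E" for A
    using mrank_mono[OF M that] by simp
  have "corank_nullity M = (\<Sum>A\<in>Pow E. var_x *
     ((var_x - 1) ^ (mrank M E - mrank M A) * (var_y - 1) ^ (card A - mrank M A)))"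
    unfolding corank_nullity_insert[OF M E]
    by (intro sum.cong) (simp_all add: iE mono algebra_simps)
  then show ?thesis
    by (simp add: corank_nullity_def E' cE sum_distrib_left)
qed

text \<open>Dual to the isthmus case: corank is the same within a pair and nullity rises by one with
  \<open>e\<close>, which gives (y - 1) + 1 = y.\<close>

lemma corank_nullity_loop:
  assumes M: "is_matroid M" and e: "is_loop M e"
  shows "corank_nullity M = var_y * corank_nullity (delete M e)"
proof -
  have eg: "e \<in> ground M" using e by (auto simp: is_loop_def)
  then obtain E where E: "ground M = insert e E" "e \<notin> E" by (meson mk_disjoint_insert)
  then have E': "ground M - {e} = E" by simp
  have fin: "finite E" using matroid_finite_ground[OF M] E by simp
  note iE = mrank_insert_loop[OF M e]
  have dE: "mrank (delete M e) A = mrank M A" if "A \<subseteq> E" for A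
    using mrank_delete[OF M] that by (simp add: E')
  have le: "Suc (card A) - mrank M A = Suc (card A - mrank M A)" if "A \<subseteq> E" for A
    using mrank_le_card[OF M finite_subset[OF that fin]] by simp
  have "corank_nullity M = (\<Sum>A\<in>Pow E. var_y *
     ((var_x - 1) ^ (mrank M E - mrank M A) * (var_y - 1) ^ (card A - mrank M A)))"
    unfolding corank_nullity_insert[OF M E]
    by (intro sum.cong) (simp_all add: iE le algebra_simps)
  then show ?thesis
    by (simp add: corank_nullity_def E' dE sum_distrib_left)
qed

lemma corank_nullity_isomorphic:
  assumes M: "is_matroid M" and "matroid_isomorphic M N"
  shows "corank_nullity M = corank_nullity N"
proof -
  obtain f where f: "bij_betw f (ground M) (ground N)"
    and fI: "\<And>I. I \<subseteq> ground M \<Longrightarrow> I \<in> indep M \<longleftrightarrow> f ` I \<in> indep N"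
    using assms(2) by (auto simp: matroid_isomorphic_def)
  have inj: "inj_on f (ground M)" and img: "ground N = f ` ground M"
    using f by (auto simp: bij_betw_def)
  have card: "card (f ` A) = card A" if "A \<subseteq> ground M" for A
    using inj_on_subset[OF inj that] by (rule card_image)
  have "bij_betw ((`) f) (Pow (ground M)) (Pow (ground N))"
    using f by (rule bij_betw_Pow)
  then show ?thesis
    unfolding corank_nullity_def
    by (subst sum.reindex_bij_betw[symmetric])
       (auto simp: img mrank_image[OF M inj fI] card intro!: sum.cong)
qed

lemma tutte_recursion_corank_nullity: "tutte_recursion (corank_nullity :: 'a matroid \<Rightarrow> bipoly)"
proof -
  have "is_matroid (Matroid {} {{}} :: 'a matroid)" by (simp add: is_matroid_def)
  \<comment> \<open>The bound makes the rank of the empty set 0, so the only summand has exponents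
    0.\<close>
  from mrank_le_card[OF this, of "{}"]
  have "corank_nullity (Matroid {} {{}} :: 'a matroid) = 1"
    by (simp add: corank_nullity_def)
  then show ?thesis
    unfolding tutte_recursion_def
    by (intro conjI allI impI)
      (assumption | erule (1) corank_nullity_isomorphic corank_nullity_nondegenerate
        corank_nullity_isthmus corank_nullity_loop)+
qed

lemma
  assumes "tutte_recursion T"
  shows tutte_recursion_empty: "T (Matroid {} {{}}) = 1"
    and tutte_recursion_nondegenerate:
      "is_matroid M \<Longrightarrow> nondegenerate M e \<Longrightarrow> T M = T (delete M e) + T (contract M e)"
    and tutte_recursion_isthmus:
      "is_matroid M \<Longrightarrow> is_isthmus M e \<Longrightarrow> T M = var_x * T (contract M e)"
    and tutte_recursion_loop:
      "is_matroid M \<Longrightarrow> is_loop M e \<Longrightarrow> T M = var_y * T (delete M e)"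
  using assms unfolding tutte_recursion_def by blast+

text \<open>Every element of a nonempty ground set is non-degenerate, an isthmus or a loop, so some
  clause reduces the value to minors with a smaller ground set.\<close>

lemma tutte_recursion_unique:
  assumes T: "tutte_recursion T" and T': "tutte_recursion T'" and "is_matroid M"
  shows "T M = T' M"
  using \<open>is_matroid M\<close>
proof (induction "card (ground M)" arbitrary: M rule: less_induct)
  case less
  note M = less.prems
  have IH: "T N = T' N" if "is_matroid N" "ground N = ground M - {e}" "e \<in> ground M" for N e
    using less.hyps[of N] that card_Diff1_less[OF matroid_finite_ground[OF M] that(3)] by simp
  show ?case
  proof (cases "ground M = {}")
    case True
    then have "M = Matroid {} {{}}"
      using M matroid_indep_ground[OF M] matroid_indep_empty[OF M] by (cases M) auto
    then show ?thesis using T T' by (simp add: tutte_recursion_empty)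
  next
    case False
    then obtain e where e: "e \<in> ground M" by blast
    have D: "T (delete M e) = T' (delete M e)"
      using IH[OF is_matroid_delete[OF M] _ e] by simp
    \<comment> \<open>Contracting a loop leaves no independent set at all, hence no matroid, so the
      induction hypothesis covers contractions only off loops; \<open>nl\<close> makes it available
      for isthmuses.\<close>
    have C: "T (contract M e) = T' (contract M e)" if "\<not> is_loop M e"
      using IH[OF is_matroid_contract[OF M] _ e] that e by (simp add: is_loop_def)
    have nl: "\<not> is_loop M e" if "is_isthmus M e"
      using indep_insert_isthmus[OF M that matroid_indep_empty[OF M]] by (simp add: is_loop_def)
    consider "nondegenerate M e" | "is_isthmus M e" | "is_loop M e"
      using e by (auto simp: nondegenerate_def)
    then show ?thesis
    proof cases
      case 1
      then show ?thesis
        using D C tutte_recursion_nondegenerate[OF T M] tutte_recursion_nondegenerate[OF T' M]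
        by (simp add: nondegenerate_def)
    next
      case 2
      then show ?thesis
        using C nl tutte_recursion_isthmus[OF T M] tutte_recursion_isthmus[OF T' M] by simp
    next
      case 3
      then show ?thesis
        using D tutte_recursion_loop[OF T M] tutte_recursion_loop[OF T' M] by simp
    qed
  qed
qed

text \<open>The description ranges over values at \<open>M\<close>, not over solutions. It is
  therefore well defined although two solutions may differ on arguments that are not
  matroids.\<close>

lemma tutte_eq_corank_nullity:
  assumes "is_matroid M"
  shows "tutte M = corank_nullity M"
  unfolding tutte_def
proof (rule the_equality)
  show "\<exists>T. tutte_recursion T \<and> T M = corank_nullity M"
    using tutte_recursion_corank_nullity by blast
  fix p
  assume "\<exists>T. tutte_recursion T \<and> T M = p"
  then show "p = corank_nullity M"
    using tutte_recursion_unique[OF _ tutte_recursion_corank_nullity assms] by metis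
qed

lemma tutte_isomorphic:
  "is_matroid M \<Longrightarrow> is_matroid N \<Longrightarrow> matroid_isomorphic M N \<Longrightarrow> tutte M = tutte N"
  by (simp add: tutte_eq_corank_nullity corank_nullity_isomorphic)

lemma tutte_nondegenerate:
  assumes "is_matroid M" "nondegenerate M e"
  shows "tutte M = tutte (delete M e) + tutte (contract M e)"
  using assms
  by (simp add: tutte_eq_corank_nullity corank_nullity_nondegenerate is_matroid_delete
      is_matroid_contract nondegenerate_def is_loop_def)

section \<open>Matroids without non-degenerate elements\<close>

text \<open>With \<open>Pow I\<close> as independent sets, the elements of \<open>I\<close> are
  isthmuses and those of \<open>E - I\<close> are loops. By \<open>no_nondegenerate_imp_Pow\<close>
  every matroid without non-degenerate elements has this form.\<close>

lemma is_matroid_Pow: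
  assumes "finite E" "I \<subseteq> E"
  shows "is_matroid (Matroid E (Pow I))"
proof -
  have "\<exists>x\<in>A - B. x \<in> I" if "A \<subseteq> I" "B \<subseteq> I" "card B < card A" for A B
    using that assms by (metis DiffI finite_subset card_mono linorder_not_le subsetD subsetI)
  then show ?thesis using assms by (auto simp: is_matroid_def)
qed

lemma tutte_Pow:
  assumes "finite E" "I \<subseteq> E"
  shows "tutte (Matroid E (Pow I)) = var_x ^ card I * var_y ^ card (E - I)"
  using assms
proof (induction "card E" arbitrary: E I)
  case 0
  then show ?case
    using tutte_recursion_empty[OF tutte_recursion_corank_nullity] is_matroid_Pow[OF 0(2,3)]
    by (simp add: tutte_eq_corank_nullity)
next
  case (Suc n)
  then obtain e where e: "e \<in> E" by (metis card.empty ex_in_conv nat.distinct(1))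
  let ?M = "Matroid E (Pow I)"
  note M = is_matroid_Pow[OF Suc.prems]
  have cE: "n = card (E - {e})" using Suc e by simp
  show ?case
  proof (cases "e \<in> I")
    case True
    have "is_basis ?M B \<Longrightarrow> B = I" for B by (auto simp: is_basis_def)
    then have "is_isthmus ?M e" using True e by (auto simp: is_isthmus_def)
    moreover have "contract ?M e = Matroid (E - {e}) (Pow (I - {e}))"
      using True Suc.prems by (auto simp: contract_def)
    moreover have "E - {e} - (I - {e}) = E - I" using True by auto
    moreover have "card I = Suc (card (I - {e}))"
      using True Suc.prems by (metis card.remove finite_subset)
    ultimately show ?thesis
      using corank_nullity_isthmus[OF M] Suc.hyps(1)[OF cE, of "I - {e}"] Suc.prems
        is_matroid_Pow[of "E - {e}" "I - {e}"] M
      by (simp add: tutte_eq_corank_nullity Diff_mono)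
  next
    case False
    then have "is_loop ?M e" using e by (auto simp: is_loop_def)
    moreover have "delete ?M e = Matroid (E - {e}) (Pow I)"
      using False Suc.prems by (auto simp: delete_def)
    moreover have "card (E - I) = Suc (card (E - {e} - I))"
      using False e Suc.prems by (metis DiffI Diff_insert Diff_insert2 card.remove finite_Diff)
    moreover have "I \<subseteq> E - {e}" using False Suc.prems by auto
    ultimately show ?thesis
      using corank_nullity_loop[OF M] Suc.hyps(1)[OF cE, of I] Suc.prems
        is_matroid_Pow[of "E - {e}" I] M
      by (simp add: tutte_eq_corank_nullity)
  qed
qed

lemma no_nondegenerate_imp_Pow:
  assumes M: "is_matroid M" and nd: "\<And>e. \<not> nondegenerate M e"
  obtains I where "I \<subseteq> ground M" "indep M = Pow I"
proof -
  \<comment> \<open>The set of isthmuses lies in every basis, so it is independent; conversely an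
    independent set contains no loops, so here all its elements are isthmuses.\<close>
  define I where "I = {e \<in> ground M. is_isthmus M e}"
  obtain B where B: "is_basis M B" using basis_extends[OF M matroid_indep_empty[OF M]] by blast
  then have "I \<subseteq> B" by (auto simp: I_def is_isthmus_def)
  then have "I \<in> indep M" using B matroid_indep_subset[OF M] by (auto simp: is_basis_def)
  moreover have "J \<subseteq> I" if "J \<in> indep M" for J
    using nd that matroid_indep_ground[OF M that] indep_not_loop[OF M _ that]
    by (auto simp: I_def nondegenerate_def)
  ultimately have "indep M = Pow I" using matroid_indep_subset[OF M] by auto
  with that show thesis by (auto simp: I_def)
qed

text \<open>The isomorphism is glued from a bijection of the isthmuses and a bijection of the loops.
  These two numbers therefore determine such a matroid up to isomorphism.\<close>

lemma isomorphic_Pow: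
  assumes "finite E" "I \<subseteq> E" "finite E'" "I' \<subseteq> E'" "card I = card I'" "card E = card E'"
  shows "matroid_isomorphic (Matroid E (Pow I)) (Matroid E' (Pow I'))"
proof -
  have fin: "finite I" "finite I'" using assms finite_subset by auto
  obtain g where g: "bij_betw g I I'" using assms fin finite_same_card_bij by blast
  have "card (E - I) = card (E' - I')" using assms fin by (simp add: card_Diff_subset)
  then obtain h where h: "bij_betw h (E - I) (E' - I')"
    using assms finite_same_card_bij by blast
  define f where "f = (\<lambda>x. if x \<in> I then g x else h x)"
  have "bij_betw f I I'" using g by (simp add: f_def cong: bij_betw_cong)
  moreover have "bij_betw f (E - I) (E' - I')"
    unfolding f_def using h by (subst bij_betw_cong[where g = h]) auto
  ultimately have "bij_betw f (I \<union> (E - I)) (I' \<union> (E' - I'))"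
    by (rule bij_betw_combine) auto
  then have "bij_betw f E E'" using assms by (simp add: Un_absorb1)
  moreover have "f x \<in> I' \<longleftrightarrow> x \<in> I" if "x \<in> E" for x
    using that bij_betwE[OF g] bij_betwE[OF h] by (auto simp: f_def)
  then have "J \<subseteq> I \<longleftrightarrow> f ` J \<subseteq> I'" if "J \<subseteq> E" for J
    using that by blast
  ultimately show ?thesis unfolding matroid_isomorphic_def by auto
qed

section \<open>Isomorphism of matroids is an equivalence relation\<close>

lemma matroid_isomorphic_refl: "matroid_isomorphic M M"
  unfolding matroid_isomorphic_def by (rule exI[of _ id]) simp

lemma matroid_isomorphic_sym:
  assumes "matroid_isomorphic M N"
  shows "matroid_isomorphic N M"
proof -
  obtain f where f: "bij_betw f (ground M) (ground N)"
    and fI: "\<And>I. I \<subseteq> ground M \<Longrightarrow> I \<in> indep M \<longleftrightarrow> f ` I \<in> indep N"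
    using assms by (auto simp: matroid_isomorphic_def)
  let ?g = "inv_into (ground M) f"
  have g: "bij_betw ?g (ground N) (ground M)" using f by (rule bij_betw_inv_into)
  have "J \<in> indep N \<longleftrightarrow> ?g ` J \<in> indep M" if "J \<subseteq> ground N" for J
  proof -
    have "?g ` J \<subseteq> ground M" using that g by (auto simp: bij_betw_def)
    moreover have "f ` ?g ` J = J"
      using that f by (simp add: bij_betw_def image_inv_into_cancel)
    ultimately show ?thesis using fI by metis
  qed
  with g show ?thesis by (auto simp: matroid_isomorphic_def)
qed

lemma matroid_isomorphic_trans:
  assumes "matroid_isomorphic L M" "matroid_isomorphic M N"
  shows "matroid_isomorphic L N"
proof -
  obtain f g where f: "bij_betw f (ground L) (ground M)" and g: "bij_betw g (ground M) (ground N)"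
    and fI: "\<And>I. I \<subseteq> ground L \<Longrightarrow> I \<in> indep L \<longleftrightarrow> f ` I \<in> indep M"
    and gI: "\<And>I. I \<subseteq> ground M \<Longrightarrow> I \<in> indep M \<longleftrightarrow> g ` I \<in> indep N"
    using assms by (auto simp: matroid_isomorphic_def)
  have "I \<in> indep L \<longleftrightarrow> (g \<circ> f) ` I \<in> indep N" if "I \<subseteq> ground L" for I
    using fI[OF that] gI[of "f ` I"] that f by (auto simp: bij_betw_def image_comp)
  with bij_betw_trans[OF f g] show ?thesis unfolding matroid_isomorphic_def by blast
qed

section \<open>The category of matroids\<close>

text \<open>Several proofs below switch off the rules that unfold \<open>Obj\<close>,
  \<open>Ident\<close>, \<open>Comp\<close> or \<open>Arr\<close>, so that facts about unspecified
  objects and arrows still match.\<close>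

lemma Mat_plus_simps [simp]:
  "Obj Mat_plus = insert None (Some ` Mat_objects)"
  "Dom Mat_plus (A, f, B) = A"
  "Cod Mat_plus (A, f, B) = B"
  "Ident Mat_plus A = (A, \<lambda>x\<in>pground A. x, A)"
  "Comp Mat_plus (B, g, D) (A, f, B') = (A, compose (pground A) g f, D)"
  "(A, f, B) \<in> Arr Mat_plus \<longleftrightarrow>
     A \<in> Obj Mat_plus \<and> B \<in> Obj Mat_plus \<and> f \<in> Mat_plus_hom A B"
  by (simp_all add: Mat_plus_def)

lemma Mat_plus_arr_Obj:
  "f \<in> Arr Mat_plus \<Longrightarrow> Dom Mat_plus f \<in> Obj Mat_plus \<and> Cod Mat_plus f \<in> Obj Mat_plus"
  by (cases f) simp

lemma Mat_tc_simps [simp]: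
  "Obj Mat_tc = Obj Mat_plus" "Dom Mat_tc = Dom Mat_plus" "Covers Mat_tc = tutte_covers"
  by (simp_all add: Mat_tc_def cat.extend_def)

lemma Mat_iso_simps [simp]:
  "Obj Mat_iso = Obj Mat_plus" "Dom Mat_iso = Dom Mat_plus" "Covers Mat_iso = iso_covers"
  by (simp_all add: Mat_iso_def cat.extend_def)

lemma Ident_in_Arr: "A \<in> Obj Mat_plus \<Longrightarrow> Ident Mat_plus A \<in> Arr Mat_plus"
proof (cases A)
  case None
  \<comment> \<open>Restricted to the empty set \<open>pground None\<close>, the identity becomes
    the constant \<open>undefined\<close>, which is the only endomorphism of the base-point.\<close>
  then show ?thesis by (auto simp: restrict_def)
next
  case (Some M)
  assume "A \<in> Obj Mat_plus"
  then have "I \<subseteq> ground M" if "I \<in> indep M" for I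
    using that Some by (auto simp: Mat_objects_def dest: matroid_indep_ground)
  then have "(\<lambda>x\<in>ground M. x) ` I = I" if "I \<in> indep M" for I
    using that image_cong[of I I "\<lambda>x\<in>ground M. x" "\<lambda>x. x"] by auto
  then show ?thesis
    using \<open>A \<in> Obj Mat_plus\<close> Some by (auto simp: Mat_hom_def inj_on_def)
qed

lemma Mat_plus_hom_extensional:
  "f \<in> Mat_plus_hom A B \<Longrightarrow> f \<in> extensional (pground A) \<and> f \<in> pground A \<rightarrow> pground B"
  by (cases A; cases B) (auto simp: Mat_hom_def PiE_def extensional_def)

text \<open>The unit laws are equations between functions on all naturals; they hold because
  underlying maps are extensional on the ground set of their source.\<close>

lemma Comp_Ident:
  assumes "f \<in> Arr Mat_plus"
  shows "Comp Mat_plus f (Ident Mat_plus (Dom Mat_plus f)) = f"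
    and "Comp Mat_plus (Ident Mat_plus (Cod Mat_plus f)) f = f"
  using assms
  by (cases f; auto dest!: Mat_plus_hom_extensional simp: compose_def extensional_def fun_eq_iff)+

lemma iso_arrow_Ident:
  assumes "A \<in> Obj Mat_plus"
  shows "iso_arrow Mat_plus (Ident Mat_plus A)"
  using Ident_in_Arr[OF assms] Comp_Ident[OF Ident_in_Arr[OF assms]]
  unfolding iso_arrow_def by (intro conjI bexI[of _ "Ident Mat_plus A"]) auto

text \<open>A morphism only sends independent sets to independent sets. The converse implication,
  which \<open>matroid_isomorphic\<close> demands, comes from applying the inverse arrow to the
  image.\<close>

lemma iso_arrow_imp_isomorphic:
  assumes "iso_arrow Mat_plus a"
  obtains "Dom Mat_plus a = None" "Cod Mat_plus a = None"
  | M N where "Dom Mat_plus a = Some M" "Cod Mat_plus a = Some N"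
      "M \<in> Mat_objects" "N \<in> Mat_objects" "matroid_isomorphic M N"
proof -
  obtain A f B where a: "a = (A, f, B)" by (cases a)
  obtain b where b: "b \<in> Arr Mat_plus" "Dom Mat_plus b = B" "Cod Mat_plus b = A"
    and ba: "Comp Mat_plus b a = Ident Mat_plus A" and ab: "Comp Mat_plus a b = Ident Mat_plus B"
    and arr: "a \<in> Arr Mat_plus"
    using assms by (auto simp: iso_arrow_def a simp del: Mat_plus_simps(1,4,5,6))
  then obtain g where g: "b = (B, g, A)" by (cases b) auto
  show thesis
  proof (cases A)
    case None
    then show thesis using arr that(1) by (cases B) (auto simp: a)
  next
    case (Some M)
    then obtain N where N: "B = Some N" using arr by (cases B) (auto simp: a)
    have M: "M \<in> Mat_objects" "N \<in> Mat_objects" "f \<in> Mat_hom M N" "g \<in> Mat_hom N M"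
      using arr b(1) by (auto simp: a g Some N)
    have "compose (ground M) g f = (\<lambda>x\<in>ground M. x)" "compose (ground N) f g = (\<lambda>x\<in>ground N. x)"
      using ba ab by (simp_all add: a g Some N)
    then have gf: "g (f x) = x" if "x \<in> ground M" for x
      using that by (metis compose_eq restrict_apply')
    have fg: "f (g y) = y" if "y \<in> ground N" for y
      using that \<open>compose (ground N) f g = _\<close> by (metis compose_eq restrict_apply')
    have "bij_betw f (ground M) (ground N)"
      using M gf fg by (intro bij_betw_byWitness[where f' = g]) (auto simp: Mat_hom_def)
    moreover have "I \<in> indep M \<longleftrightarrow> f ` I \<in> indep N" if "I \<subseteq> ground M" for I
    proof -
      have "g ` f ` I = I"
        unfolding image_image using gf that by (subst image_cong[where g = "\<lambda>x. x"]) auto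
      moreover have "f ` I \<in> indep N" if "I \<in> indep M"
        using M that by (auto simp: Mat_hom_def)
      moreover have "g ` f ` I \<in> indep M" if "f ` I \<in> indep N"
        using M that by (auto simp: Mat_hom_def)
      ultimately show ?thesis by metis
    qed
    ultimately have "matroid_isomorphic M N" by (auto simp: matroid_isomorphic_def)
    then show thesis using that(2) M by (auto simp: a Some N)
  qed
qed

lemma isomorphic_imp_iso_arrow:
  assumes M: "M \<in> Mat_objects" and N: "N \<in> Mat_objects" and iso: "matroid_isomorphic M N"
  obtains f where "iso_arrow Mat_plus (Some M, f, Some N)"
proof -
  obtain f0 where f0: "bij_betw f0 (ground M) (ground N)"
    and fI0: "\<And>I. I \<subseteq> ground M \<Longrightarrow> I \<in> indep M \<longleftrightarrow> f0 ` I \<in> indep N"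
    using iso by (auto simp: matroid_isomorphic_def)
  \<comment> \<open>Restricting the bijection and its inverse makes them extensional, so that they
    are underlying maps of arrows and their composites are literally the identities.\<close>
  define f where "f = restrict f0 (ground M)"
  define g where "g = restrict (inv_into (ground M) f0) (ground N)"
  have bf: "bij_betw f (ground M) (ground N)"
    using f0 unfolding f_def by (subst bij_betw_cong[where g = f0]) auto
  have bg: "bij_betw g (ground N) (ground M)"
    using bij_betw_inv_into[OF f0] unfolding g_def
    by (subst bij_betw_cong[where g = "inv_into (ground M) f0"]) auto
  have gf: "g (f x) = x" if "x \<in> ground M" for x
    using that f0 bij_betwE[OF f0] by (simp add: f_def g_def bij_betw_inv_into_left)
  have fg: "f (g y) = y" if "y \<in> ground N" for y
    using that f0 bij_betwE[OF bij_betw_inv_into[OF f0]]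
    by (simp add: f_def g_def bij_betw_inv_into_right)
  have fI: "I \<in> indep M \<longleftrightarrow> f ` I \<in> indep N" if "I \<subseteq> ground M" for I
  proof -
    have "f ` I = f0 ` I" using that by (intro image_cong) (auto simp: f_def)
    then show ?thesis using fI0[OF that] by simp
  qed
  have indM: "I \<subseteq> ground M" if "I \<in> indep M" for I
    using M that matroid_indep_ground by (auto simp: Mat_objects_def)
  have indN: "I \<subseteq> ground N" if "I \<in> indep N" for I
    using N that matroid_indep_ground by (auto simp: Mat_objects_def)
  have "f \<in> Mat_hom M N"
    using bf fI indM by (auto simp: Mat_hom_def bij_betw_def f_def)
  moreover have "g \<in> Mat_hom N M"
  proof -
    have "g ` I \<in> indep M" if I: "I \<in> indep N" for I
    proof -
      have "f ` g ` I = I"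
        unfolding image_image using fg indN[OF I] by (subst image_cong[where g = "\<lambda>x. x"]) auto
      moreover have "g ` I \<subseteq> ground M" using bg indN[OF I] by (auto simp: bij_betw_def)
      ultimately show ?thesis using fI I by metis
    qed
    then show ?thesis using bg by (auto simp: Mat_hom_def bij_betw_def g_def)
  qed
  moreover have "compose (ground M) g f = (\<lambda>x\<in>ground M. x)"
    "compose (ground N) f g = (\<lambda>x\<in>ground N. x)"
    using gf fg by (auto simp: compose_def fun_eq_iff)
  ultimately have "iso_arrow Mat_plus (Some M, f, Some N)"
    using M N unfolding iso_arrow_def by (intro conjI bexI[of _ "(Some N, g, Some M)"]) auto
  then show thesis by (rule that)
qed

section \<open>Minors as objects and standard inclusions as arrows\<close>

lemma Mat_objects_delete: "M \<in> Mat_objects \<Longrightarrow> delete M e \<in> Mat_objects"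
  by (auto simp: Mat_objects_def is_matroid_delete)

lemma Mat_objects_contract:
  "M \<in> Mat_objects \<Longrightarrow> nondegenerate M e \<Longrightarrow> contract M e \<in> Mat_objects"
  by (auto simp: Mat_objects_def is_matroid_contract nondegenerate_def is_loop_def)

lemma inclusion_in_Arr:
  assumes M: "M \<in> Mat_objects" and N: "N \<in> Mat_objects" and "ground M \<subseteq> ground N" and "indep M \<subseteq> indep N"
  shows "inclusion M N \<in> Arr Mat_plus"
proof -
  have "(\<lambda>x\<in>ground M. x) ` I = I" if "I \<in> indep M" for I
  proof -
    have "I \<subseteq> ground M" using that M by (auto simp: Mat_objects_def dest: matroid_indep_ground)
    then show ?thesis using image_cong[of I I "\<lambda>x\<in>ground M. x" "\<lambda>x. x"] by auto
  qed
  then show ?thesis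
    using assms by (auto simp: inclusion_def Mat_hom_def inj_on_def)
qed

lemma
  assumes M: "M \<in> Mat_objects" and e: "nondegenerate M e"
  shows inclusion_delete_in_Arr: "inclusion (delete M e) M \<in> Arr Mat_plus"
    and inclusion_contract_in_Arr: "inclusion (contract M e) M \<in> Arr Mat_plus"
proof -
  \<comment> \<open>A set independent in the contraction is independent in \<open>M\<close>, being a
    subset of itself enlarged by \<open>e\<close>.\<close>
  have "I \<in> indep M" if "insert e I \<in> indep M" for I
    using matroid_indep_subset[of M "insert e I" I] M that by (auto simp: Mat_objects_def)
  then show "inclusion (contract M e) M \<in> Arr Mat_plus"
    using assms by (intro inclusion_in_Arr Mat_objects_contract) (auto simp: indep_contract)
  show "inclusion (delete M e) M \<in> Arr Mat_plus"
    using assms by (intro inclusion_in_Arr Mat_objects_delete) (auto simp: indep_delete)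
qed

section \<open>Additivity of the Tutte polynomial on coverings\<close>

text \<open>The value 0 at the base-point is forced by the empty covering family of the
  base-point.\<close>

definition tutte_value :: "nat matroid option \<Rightarrow> bipoly" where
  "tutte_value A = (case A of None \<Rightarrow> 0 | Some M \<Rightarrow> tutte M)"

lemma tutte_value_simps [simp]: "tutte_value None = 0" "tutte_value (Some M) = tutte M"
  by (simp_all add: tutte_value_def)

lemma tutte_value_iso_arrow:
  assumes "iso_arrow Mat_plus a"
  shows "tutte_value (Dom Mat_plus a) = tutte_value (Cod Mat_plus a)"
  using assms
  by (elim iso_arrow_imp_isomorphic) (auto simp: Mat_objects_def intro: tutte_isomorphic)

section \<open>Leaves below a vertex of a binary tree\<close>

lemma rooted_binary_tree_prefix:
  assumes "rooted_binary_tree T" "v @ u \<in> T"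
  shows "v \<in> T"
  using assms(2)
proof (induction u rule: rev_induct)
  case (snoc b u)
  then show ?case using assms(1) by (metis append.assoc rooted_binary_tree_def)
qed simp

text \<open>These cases mirror the clauses of \<open>elementary_dc_tree\<close>: leaf, repeated
  object, deletion-contraction.\<close>

lemma children_cases:
  obtains "children T v = {}"
  | w where "children T v = {w}"
  | w1 w2 where "w1 \<noteq> w2" "children T v = {w1, w2}"
proof -
  have "children T v \<subseteq> {v @ [True], v @ [False]}"
    unfolding children_def by (smt (verit) insert_iff mem_Collect_eq subsetI)
  then have "children T v \<in> {{}, {v @ [True]}, {v @ [False]}, {v @ [True], v @ [False]}}"
    by blast
  then show thesis
    using that(1) that(2)[of "v @ [True]"] that(2)[of "v @ [False]"]
      that(3)[of "v @ [True]" "v @ [False]"] by auto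
qed

text \<open>The local form of \<open>leaves\<close> that an induction over vertices requires; at the
  root it gives all leaves.\<close>

definition leaves_below :: "vertex set \<Rightarrow> vertex \<Rightarrow> vertex set" where
  "leaves_below T v = {w \<in> leaves T. prefix v w}"

lemma leaves_below_leaf:
  assumes T: "rooted_binary_tree T" and v: "v \<in> T" "children T v = {}"
  shows "leaves_below T v = {v}"
proof -
  have "w = v" if "w \<in> T" "prefix v w" for w
  proof -
    obtain u where u: "w = v @ u" using \<open>prefix v w\<close> by (auto elim: prefixE)
    show ?thesis
    proof (cases u)
      case (Cons b u')
      then have "v @ [b] \<in> T"
        using rooted_binary_tree_prefix[OF T, of "v @ [b]" u'] that u by simp
      then show ?thesis using v by (auto simp: children_def)
    qed (simp add: u)
  qed
  then show ?thesis using v by (auto simp: leaves_below_def leaves_def)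
qed

lemma leaves_below_internal:
  assumes T: "rooted_binary_tree T" and v: "children T v \<noteq> {}"
  shows "leaves_below T v = (\<Union>c\<in>children T v. leaves_below T c)"
proof -
  have "\<exists>c\<in>children T v. prefix c w" if "w \<in> leaves T" "prefix v w" for w
  proof -
    obtain u where u: "w = v @ u" using \<open>prefix v w\<close> by (auto elim: prefixE)
    moreover have "w \<noteq> v" using that v by (auto simp: leaves_def)
    ultimately obtain b u' where "w = (v @ [b]) @ u'" by (cases u) auto
    moreover from this have "v @ [b] \<in> T"
      using rooted_binary_tree_prefix[OF T, of "v @ [b]" u'] that by (simp add: leaves_def)
    ultimately show ?thesis by (auto simp: children_def)
  qed
  moreover have "prefix v w" if "c \<in> children T v" "prefix c w" for c w
    using that by (auto simp: children_def dest: append_prefixD)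
  ultimately show ?thesis by (auto simp: leaves_below_def)
qed

lemma leaves_below_disjoint:
  assumes "c \<in> children T v" "d \<in> children T v" "c \<noteq> d"
  shows "leaves_below T c \<inter> leaves_below T d = {}"
proof -
  have "\<not> (prefix c w \<and> prefix d w)" for w
    using assms by (auto simp: children_def elim!: prefixE)
  then show ?thesis by (auto simp: leaves_below_def)
qed

text \<open>The value is carried from the leaves upwards: an only child repeats the object, and at a
  branching the deletion-contraction formula splits the value along the disjoint sets of leaves
  below the two children.\<close>

lemma elementary_dc_tree_tutte_value:
  assumes T: "rooted_binary_tree T" and G: "elementary_dc_tree T G" and "v \<in> T"
  shows "tutte_value (OMap G v) = (\<Sum>w\<in>leaves_below T v. tutte_value (OMap G w))"
  using \<open>v \<in> T\<close>
proof (induction "card {w \<in> T. prefix v w}" arbitrary: v rule: less_induct)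
  case less
  have fin: "finite T" using T by (simp add: rooted_binary_tree_def)
  have finl: "finite (leaves_below T u)" for u
    using fin by (simp add: leaves_below_def leaves_def)
  have IH: "tutte_value (OMap G c) = (\<Sum>w\<in>leaves_below T c. tutte_value (OMap G w))"
    if c: "c \<in> children T v" for c
  proof (rule less.hyps)
    show "c \<in> T" using c by (auto simp: children_def)
    have "{w \<in> T. prefix c w} \<subseteq> {w \<in> T. prefix v w}"
      using c by (auto simp: children_def dest: append_prefixD)
    \<comment> \<open>The vertex \<open>v\<close> itself witnesses that passing to a child strictly
      shrinks the set of vertices below.\<close>
    moreover have "v \<in> {w \<in> T. prefix v w}" "v \<notin> {w \<in> T. prefix c w}"
      using less.prems c by (auto simp: children_def dest: prefix_length_le)
    ultimately show "card {w \<in> T. prefix c w} < card {w \<in> T. prefix v w}"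
      using fin by (intro psubset_card_mono) auto
  qed
  show ?case
  proof (cases rule: children_cases[of T v])
    case 1
    then show ?thesis using leaves_below_leaf[OF T less.prems] by simp
  next
    case (2 w)
    then have "OMap G w = OMap G v"
      using G less.prems unfolding elementary_dc_tree_def by blast
    then show ?thesis using IH[of w] leaves_below_internal[OF T, of v] 2 by simp
  next
    case (3 w1 w2)
    then obtain N N1 N2 e where N: "OMap G v = Some N" "OMap G w1 = Some N1" "OMap G w2 = Some N2"
      "nondegenerate N e"
      "N1 = contract N e \<and> N2 = delete N e \<or> N1 = delete N e \<and> N2 = contract N e"
      using G less.prems unfolding elementary_dc_tree_def by blast
    \<comment> \<open>Functoriality puts the values at vertices among the objects, so
      \<open>N\<close> is a matroid and the formula for \<open>tutte\<close> applies to it.\<close>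
    have "is_functor (tree_cat T) Mat_plus G" using G by (simp add: elementary_dc_tree_def)
    then have "OMap G v \<in> Obj Mat_plus"
      using less.prems unfolding is_functor_def tree_cat_def by simp
    then have "is_matroid N" using N by (auto simp: Mat_objects_def)
    then have "tutte N = tutte N1 + tutte N2"
      using tutte_nondegenerate[OF _ N(4)] N(5) by auto
    moreover have "leaves_below T w1 \<inter> leaves_below T w2 = {}"
      using leaves_below_disjoint[of w1 T v w2] 3 by simp
    ultimately show ?thesis
      using IH[of w1] IH[of w2] leaves_below_internal[OF T, of v] 3 N finl
      by (simp add: sum.union_disjoint)
  qed
qed

text \<open>The relations of \<open>K0\<close> see a covering only through the sources of its
  arrows, and functoriality identifies these with the values at the leaves.\<close>

lemma leaf_to_root_Dom:
  assumes T: "rooted_binary_tree T" and F: "is_functor (tree_cat T) Mat_plus F"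
  shows "(\<Sum>f\<in>#leaf_to_root T F. \<phi> (Dom Mat_plus f)) = (\<Sum>v\<in>leaves T. \<phi> (OMap F v))"
proof -
  have "Dom Mat_plus (AMap F (v, [])) = OMap F v" if "v \<in> T" for v
    using F T that by (simp add: is_functor_def tree_cat_def rooted_binary_tree_def)
  moreover have "finite (leaves T)" using T by (simp add: rooted_binary_tree_def leaves_def)
  ultimately show ?thesis
    by (auto simp: leaf_to_root_def image_mset.compositionality comp_def sum_unfold_sum_mset
        leaves_def
        intro!: arg_cong[where f = sum_mset] image_mset_cong)
qed

text \<open>A natural isomorphism to an elementary tree gives isomorphic objects at each vertex, so
  the isomorphism invariance of the Tutte polynomial transports the additivity.\<close>

lemma dc_tree_tutte_value:
  assumes T: "rooted_binary_tree T" and F: "dc_tree T F"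
  shows "tutte_value (OMap F []) = (\<Sum>v\<in>leaves T. tutte_value (OMap F v))"
proof -
  obtain G where G: "elementary_dc_tree T G" and "naturally_isomorphic (tree_cat T) Mat_plus F G"
    using F by (auto simp: dc_tree_def)
  then obtain \<eta> where "iso_arrow Mat_plus (\<eta> v) \<and> Dom Mat_plus (\<eta> v) = OMap F v \<and>
      Cod Mat_plus (\<eta> v) = OMap G v" if "v \<in> T" for v
    unfolding naturally_isomorphic_def tree_cat_def by auto
  then have eq: "tutte_value (OMap F v) = tutte_value (OMap G v)" if "v \<in> T" for v
    using tutte_value_iso_arrow that by metis
  have "leaves_below T [] = leaves T" by (simp add: leaves_below_def)
  moreover have "[] \<in> T" using T by (simp add: rooted_binary_tree_def)
  ultimately show ?thesis
    using elementary_dc_tree_tutte_value[OF T G] eq by (simp add: leaves_def)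
qed

lemma tutte_covers_cases:
  assumes "(B, Q) \<in> tutte_covers"
  obtains (base) n where "B = None" "Q = replicate_mset n (Ident Mat_plus None)"
  | (tree) M T F where "B = Some M" "Q = leaf_to_root T F" "M \<in> Mat_objects"
      "rooted_binary_tree T" "dc_tree T F" "is_functor (tree_cat T) Mat_plus F" "OMap F [] = Some M"
proof -
  have "is_functor (tree_cat T) Mat_plus F" if "dc_tree T F" for T F
    using that by (simp add: dc_tree_def)
  then show thesis
    using assms base tree unfolding tutte_covers_def base_covers_def by fast
qed

lemma tutte_coversI:
  assumes "M \<in> Mat_objects" "rooted_binary_tree T" "dc_tree T F" "OMap F [] = Some M"
  shows "(Some M, leaf_to_root T F) \<in> tutte_covers"
  using assms unfolding tutte_covers_def by blast

lemma tutte_covers_Obj: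
  assumes "(B, Q) \<in> tutte_covers"
  shows "B \<in> Obj Mat_plus" and "f \<in># Q \<Longrightarrow> Dom Mat_plus f \<in> Obj Mat_plus"
proof -
  have "B \<in> Obj Mat_plus \<and> (f \<in># Q \<longrightarrow> Dom Mat_plus f \<in> Obj Mat_plus)"
    using assms
  proof (cases rule: tutte_covers_cases)
    case base
    then show ?thesis by auto
  next
    case (tree M T F)
    have "AMap F (v, []) \<in> Arr Mat_plus" if "v \<in> leaves T" for v
      using tree(4,6) that
      by (simp add: is_functor_def tree_cat_def rooted_binary_tree_def leaves_def)
    moreover have "finite (leaves T)" using tree(4) by (simp add: rooted_binary_tree_def leaves_def)
    ultimately have "f \<in> Arr Mat_plus" if "f \<in># Q" for f
      using that by (auto simp: tree(2) leaf_to_root_def)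
    then have "Dom Mat_plus f \<in> Obj Mat_plus" if "f \<in># Q" for f
      using that Mat_plus_arr_Obj by blast
    then show ?thesis using tree(1,3) by simp
  qed
  then show "B \<in> Obj Mat_plus" and "f \<in># Q \<Longrightarrow> Dom Mat_plus f \<in> Obj Mat_plus" by auto
qed

lemma tutte_covers_tutte_value:
  assumes "(B, Q) \<in> tutte_covers"
  shows "tutte_value B = (\<Sum>f\<in>#Q. tutte_value (Dom Mat_plus f))"
  using assms
proof (cases rule: tutte_covers_cases)
  case (tree M T F)
  then show ?thesis
    using leaf_to_root_Dom[of T F tutte_value] dc_tree_tutte_value[of T F] by simp
qed simp

section \<open>The generating coverings\<close>

text \<open>A tree of height at most one is given by objects \<open>X v\<close> at its vertices and arrows \<open>a v\<close> from
  them to the root.\<close>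

definition star_functor :: "(vertex \<Rightarrow> nat matroid option) \<Rightarrow> (vertex \<Rightarrow> mat_arrow) \<Rightarrow> tree_functor" where
  "star_functor X a = \<lparr>OMap = X, AMap = (\<lambda>(w, v). if w = v then Ident Mat_plus (X v) else a w)\<rparr>"

text \<open>In height at most one, an arrow between distinct vertices ends at the root. Each
  composable pair therefore contains an identity, and functoriality reduces to the unit
  laws.\<close>

lemma is_functor_star_functor:
  assumes T: "\<And>v. v \<in> T \<Longrightarrow> length v \<le> 1"
    and X: "\<And>v. v \<in> T \<Longrightarrow> X v \<in> Obj Mat_plus"
    and a: "\<And>v. v \<in> T \<Longrightarrow> v \<noteq> [] \<Longrightarrow>
      a v \<in> Arr Mat_plus \<and> Dom Mat_plus (a v) = X v \<and> Cod Mat_plus (a v) = X []"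
  shows "is_functor (tree_cat T) Mat_plus (star_functor X a)"
proof -
  define A where "A = AMap (star_functor X a)"
  have A_id: "A (v, v) = Ident Mat_plus (X v)" and A_root: "w \<noteq> v \<Longrightarrow> A (w, v) = a w" for w v
    by (simp_all add: A_def star_functor_def del: Mat_plus_simps)
  have Nil: "v = []" if "w \<in> T" "prefix v w" "v \<noteq> w" for v w
    using T[OF that(1)] that(2,3) by (cases w) (auto simp: prefix_Cons)
  have arr: "A (w, v) \<in> Arr Mat_plus \<and> Dom Mat_plus (A (w, v)) = X w \<and> Cod Mat_plus (A (w, v)) = X v"
    if "w \<in> T" "prefix v w" for w v
  proof (cases "w = v")
    case True
    then show ?thesis using Ident_in_Arr[OF X[OF that(1)]] unfolding True A_id by simp
  next
    case False
    then show ?thesis using Nil[OF that] a[OF that(1)] A_root[OF False] by metis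
  qed
  have comp: "A (w, u) = Comp Mat_plus (A (v, u)) (A (w, v))"
    if "w \<in> T" "v \<in> T" "prefix u v" "prefix v w" for u v w
  proof (cases "w = v")
    case True
    then show ?thesis using Comp_Ident(1)[of "A (v, u)"] arr[OF that(2,3)] A_id by metis
  next
    case False
    then have "u = v" using Nil[OF that(1,4)] that(3) by auto
    then show ?thesis using Comp_Ident(2)[of "A (w, v)"] arr[OF that(1,4)] A_id by metis
  qed
  have "OMap (star_functor X a) = X" by (simp add: star_functor_def)
  moreover have "A (Comp (tree_cat T) g f) = Comp Mat_plus (A g) (A f)"
    if "f \<in> Arr (tree_cat T)" "g \<in> Arr (tree_cat T)" "Dom (tree_cat T) g = Cod (tree_cat T) f" for f g
    using that comp[of "fst f" "snd f" "snd g"] by (cases f; cases g) (simp add: tree_cat_def)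
  moreover have "A f \<in> Arr Mat_plus \<and> Dom Mat_plus (A f) = X (Dom (tree_cat T) f) \<and>
      Cod Mat_plus (A f) = X (Cod (tree_cat T) f)" if "f \<in> Arr (tree_cat T)" for f
    using that arr[of "fst f" "snd f"] by (cases f) (simp add: tree_cat_def)
  moreover have "X v \<in> Obj Mat_plus \<and> A (Ident (tree_cat T) v) = Ident Mat_plus (X v)"
    if "v \<in> Obj (tree_cat T)" for v
    using X that unfolding tree_cat_def cat.simps A_id by simp
  ultimately show ?thesis
    unfolding is_functor_def A_def by metis
qed

lemma naturally_isomorphic_Mat_plus_refl:
  assumes "is_functor C Mat_plus F" and "is_category C"
  shows "naturally_isomorphic C Mat_plus F F"
proof -
  have "iso_arrow Mat_plus (Ident Mat_plus (OMap F A))" if "A \<in> Obj C" for A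
    using assms(1) that by (intro iso_arrow_Ident) (simp add: is_functor_def)
  moreover have "Comp Mat_plus (Ident Mat_plus (OMap F (Cod C f))) (AMap F f) =
      Comp Mat_plus (AMap F f) (Ident Mat_plus (OMap F (Dom C f)))" if "f \<in> Arr C" for f
    using assms(1) that Comp_Ident[of "AMap F f"] by (simp add: is_functor_def del: Mat_plus_simps)
  ultimately show ?thesis
    unfolding naturally_isomorphic_def
    by (intro exI[of _ "\<lambda>A. Ident Mat_plus (OMap F A)"]) auto
qed

lemma is_category_tree_cat: "is_category (tree_cat T)"
  by (auto simp: is_category_def tree_cat_def intro: prefix_order.trans)

text \<open>An elementary tree allows only identities along an unbranched edge. The isomorphism
  enters through naturality: the edge labelled by \<open>f\<close> is isomorphic to the edge
  labelled by the identity of \<open>N\<close>, via \<open>f\<close> at the leaf and the identity at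
  the root.\<close>

lemma isomorphism_cover:
  assumes "M \<in> Mat_objects" "N \<in> Mat_objects" "iso_arrow Mat_plus (Some M, f, Some N)"
  shows "(Some N, {#(Some M, f, Some N)#}) \<in> tutte_covers"
proof -
  define T where "T = {[], [True]}"
  define X where "X v = (if v = [] then Some N else Some M)" for v :: vertex
  define F where "F = star_functor X (\<lambda>_. (Some M, f, Some N))"
  define G where "G = star_functor (\<lambda>_. Some N) (\<lambda>_. Ident Mat_plus (Some N))"
  define \<eta> where "\<eta> v = (if v = [] then Ident Mat_plus (Some N) else (Some M, f, Some N))" for v :: vertex
  have arr: "(Some M, f, Some N) \<in> Arr Mat_plus" using assms(3) by (simp add: iso_arrow_def)
  have obj: "Some M \<in> Obj Mat_plus" "Some N \<in> Obj Mat_plus" using assms by simp_all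
  have T: "rooted_binary_tree T" by (auto simp: T_def rooted_binary_tree_def)
  have ch: "children T [] = {[True]}" "children T [True] = {}"
    by (auto simp: T_def children_def)
  have cases: "v = [] \<or> v = [True]" if "v \<in> T" for v using that by (simp add: T_def)
  have mem: "[True] \<in> T" by (simp add: T_def)
  have F: "is_functor (tree_cat T) Mat_plus F"
    unfolding F_def using arr obj
    by (intro is_functor_star_functor) (auto simp: T_def X_def simp del: Mat_plus_simps(1,6))
  have "is_functor (tree_cat T) Mat_plus G"
    unfolding G_def using Ident_in_Arr[OF obj(2)] obj
    by (intro is_functor_star_functor) (auto simp: T_def simp del: Mat_plus_simps(1,6))
  then have G: "elementary_dc_tree T G"
    using cases ch unfolding elementary_dc_tree_def
    by (auto simp: G_def star_functor_def dest!: cases)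
  have "Comp Mat_plus (\<eta> v) (AMap F (w, v)) = Comp Mat_plus (AMap G (w, v)) (\<eta> w)"
    if "w \<in> T" "v \<in> T" "prefix v w" for w v
    using that Comp_Ident[OF arr]
    by (auto simp: T_def \<eta>_def F_def G_def X_def star_functor_def)
  moreover have "iso_arrow Mat_plus (\<eta> v) \<and> Dom Mat_plus (\<eta> v) = OMap F v \<and> Cod Mat_plus (\<eta> v) = OMap G v"
    for v
    using assms(3) iso_arrow_Ident[OF obj(2)] by (simp add: \<eta>_def F_def G_def X_def star_functor_def)
  ultimately have "naturally_isomorphic (tree_cat T) Mat_plus F G"
    unfolding naturally_isomorphic_def by (intro exI[of _ \<eta>]) (auto simp: tree_cat_def)
  then have "dc_tree T F" using F G by (auto simp: dc_tree_def)
  moreover have "OMap F [] = Some N" by (simp add: F_def star_functor_def X_def)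
  moreover have "leaves T = {[True]}" using ch cases mem by (auto simp: leaves_def)
  then have "leaf_to_root T F = {#(Some M, f, Some N)#}"
    by (simp add: leaf_to_root_def F_def star_functor_def)
  ultimately show ?thesis using T assms(2) tutte_coversI by metis
qed

lemma deletion_contraction_cover:
  assumes M: "M \<in> Mat_objects" and e: "nondegenerate M e"
  shows "(Some M, {#inclusion (contract M e) M, inclusion (delete M e) M#}) \<in> tutte_covers"
proof -
  define T where "T = {[], [True], [False]}"
  define X where "X v = (if v = [] then M else if v = [True] then contract M e else delete M e)"
    for v :: vertex
  define F where "F = star_functor (\<lambda>v. Some (X v)) (\<lambda>v. inclusion (X v) M)"
  have T: "rooted_binary_tree T" by (auto simp: T_def rooted_binary_tree_def)
  have ch: "children T [] = {[True], [False]}" "children T [True] = {}" "children T [False] = {}"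
    by (auto simp: T_def children_def)
  have cases: "v = [] \<or> v = [True] \<or> v = [False]" if "v \<in> T" for v using that by (simp add: T_def)
  have mem: "[True] \<in> T" "[False] \<in> T" by (simp_all add: T_def)
  have obj: "Some (X v) \<in> Obj Mat_plus" for v
    using Mat_objects_contract[OF M e] Mat_objects_delete[OF M] M by (simp add: X_def)
  have arr: "inclusion (X v) M \<in> Arr Mat_plus" if "v \<noteq> []" for v
    using that inclusion_delete_in_Arr[OF M e] inclusion_contract_in_Arr[OF M e] by (simp add: X_def)
  have F: "is_functor (tree_cat T) Mat_plus F"
    unfolding F_def
  proof (rule is_functor_star_functor)
    show "length v \<le> 1" if "v \<in> T" for v using cases[OF that] by auto
    show "Some (X v) \<in> Obj Mat_plus" for v by (fact obj)
    show "inclusion (X v) M \<in> Arr Mat_plus \<and> Dom Mat_plus (inclusion (X v) M) = Some (X v) \<and>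
        Cod Mat_plus (inclusion (X v) M) = Some (X [])" if "v \<noteq> []" for v
      using arr[OF that] by (simp add: inclusion_def X_def[of "[]"] del: Mat_plus_simps(6))
  qed
  \<comment> \<open>Makes the clause on only children vacuous: the root has two children and the
    other vertices have none.\<close>
  have single: "children T v \<noteq> {w}" if "v \<in> T" for v w
    using cases[OF that] by (elim disjE) (auto simp: ch)
  have pair: "\<exists>N N1 N2 e. OMap F v = Some N \<and> OMap F w1 = Some N1 \<and> OMap F w2 = Some N2 \<and>
      nondegenerate N e \<and>
      (N1 = contract N e \<and> N2 = delete N e \<or> N1 = delete N e \<and> N2 = contract N e) \<and>
      AMap F (w1, v) = inclusion N1 N \<and> AMap F (w2, v) = inclusion N2 N"
    if "v \<in> T" "children T v = {w1, w2}" for v w1 w2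
  proof -
    have v: "v = []" using cases[OF that(1)] that(2) by (elim disjE) (simp_all add: ch)
    \<comment> \<open>Equality of sets does not fix the order of the two children, so both namings
      must be treated.\<close>
    then have "w1 = [True] \<and> w2 = [False] \<or> w1 = [False] \<and> w2 = [True]"
      using that(2) ch(1) by (auto simp: doubleton_eq_iff)
    then show ?thesis
      using e by (intro exI[of _ M] exI[of _ "X w1"] exI[of _ "X w2"] exI[of _ e])
        (auto simp: v F_def star_functor_def X_def)
  qed
  have root: "OMap F [] = Some M" by (simp add: F_def star_functor_def X_def)
  have el: "elementary_dc_tree T F"
    unfolding elementary_dc_tree_def
  proof (intro conjI ballI allI impI)
    show "OMap F [] \<noteq> None" using root by simp
    show "is_functor (tree_cat T) Mat_plus F" by (fact F)
  next
    fix v w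
    assume "v \<in> T" "children T v = {w}"
    then show "OMap F w = OMap F v" "AMap F (w, v) = Ident Mat_plus (OMap F v)"
      using single by blast+
  qed (rule pair)
  have "naturally_isomorphic (tree_cat T) Mat_plus F F"
    using F is_category_tree_cat by (rule naturally_isomorphic_Mat_plus_refl)
  then have "dc_tree T F" using F el by (auto simp: dc_tree_def)
  moreover have "leaves T = {[True], [False]}"
  proof (rule Set.set_eqI)
    show "v \<in> leaves T \<longleftrightarrow> v \<in> {[True], [False]}" for v
      using cases[of v] mem by (auto simp: leaves_def ch)
  qed
  then have "leaf_to_root T F = {#inclusion (contract M e) M, inclusion (delete M e) M#}"
    by (simp add: leaf_to_root_def F_def star_functor_def X_def)
  ultimately show ?thesis using T M root tutte_coversI by metis
qed

section \<open>Linear extension\<close>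

text \<open>The counterpart of \<open>frag_extend\<close> for values in a ring, in the shape of
  \<open>tutte_hom\<close>.\<close>

definition lin_ext :: "('a \<Rightarrow> 'b::ring_1) \<Rightarrow> ('a \<Rightarrow>\<^sub>0 int) \<Rightarrow> 'b" where
  "lin_ext f c = (\<Sum>k\<in>Poly_Mapping.keys c. of_int (Poly_Mapping.lookup c k) * f k)"

text \<open>Addition and subtraction can cancel keys; summing over a common finite superset makes
  the linearity visible term by term.\<close>

lemma lin_ext_superset:
  assumes "finite K" "Poly_Mapping.keys c \<subseteq> K"
  shows "lin_ext f c = (\<Sum>k\<in>K. of_int (Poly_Mapping.lookup c k) * f k)"
  unfolding lin_ext_def using assms
  by (intro sum.mono_neutral_left) (auto simp: in_keys_iff)

lemma lin_ext_0 [simp]: "lin_ext f 0 = 0"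
  by (simp add: lin_ext_def)

lemma lin_ext_frag_of [simp]: "lin_ext f (frag_of a) = f a"
  by (simp add: lin_ext_def keys_frag_of)

lemma
  shows lin_ext_add: "lin_ext f (c + d) = lin_ext f c + lin_ext f d"
    and lin_ext_diff: "lin_ext f (c - d) = lin_ext f c - lin_ext f d"
proof -
  define K where "K = Poly_Mapping.keys c \<union> Poly_Mapping.keys d"
  have K: "finite K" "Poly_Mapping.keys c \<subseteq> K" "Poly_Mapping.keys d \<subseteq> K"
    "Poly_Mapping.keys (c + d) \<subseteq> K" "Poly_Mapping.keys (c - d) \<subseteq> K"
    using keys_add[of c d] keys_diff[of c d] by (auto simp: K_def)
  show "lin_ext f (c + d) = lin_ext f c + lin_ext f d"
    using K by (simp add: lin_ext_superset[of K] lookup_add algebra_simps sum.distrib)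
  show "lin_ext f (c - d) = lin_ext f c - lin_ext f d"
    using K by (simp add: lin_ext_superset[of K] lookup_minus algebra_simps sum_subtractf)
qed

lemma lin_ext_sum: "lin_ext f (\<Sum>i\<in>I. c i) = (\<Sum>i\<in>I. lin_ext f (c i))"
  by (induction I rule: infinite_finite_induct) (simp_all add: lin_ext_add)

lemma lin_ext_cmul: "lin_ext f (frag_cmul n c) = of_int n * lin_ext f c"
proof -
  have "Poly_Mapping.keys (frag_cmul n c) \<subseteq> Poly_Mapping.keys c" by (rule keys_cmul)
  then show ?thesis
    by (simp add: lin_ext_superset[of "Poly_Mapping.keys c"] sum_distrib_left mult.assoc)
qed

lemma tutte_hom_eq_lin_ext: "tutte_hom = lin_ext (\<lambda>K. the_elem (tutte ` K))"
  by (simp add: fun_eq_iff tutte_hom_def lin_ext_def)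

section \<open>A right inverse of the Tutte homomorphism\<close>

text \<open>The ground set starts at 1 to give an object of the category; \<open>{1..i}\<close> are
  the isthmuses and the remaining elements the loops.\<close>

definition monomial_matroid :: "nat \<Rightarrow> nat \<Rightarrow> nat matroid" where
  "monomial_matroid i j = Matroid {1..i + j} (Pow {1..i})"

lemma monomial_matroid_object: "monomial_matroid i j \<in> Mat_objects"
  by (auto simp: monomial_matroid_def Mat_objects_def intro: is_matroid_Pow)

text \<open>In \<open>bipoly\<close> the outer exponent belongs to y and the inner one to x.\<close>

lemma var_x_power_var_y_power: "var_x ^ i * var_y ^ j = monom (monom 1 i) j"
proof -
  have "var_x ^ i = [:monom 1 i:]"
    by (induction i) (simp_all add: var_x_def monom_Suc one_pCons monom_0)
  moreover have "var_y ^ j = monom 1 j"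
    by (simp add: var_y_def monom_altdef)
  ultimately show ?thesis by (simp add: smult_monom)
qed

lemma tutte_monomial_matroid: "tutte (monomial_matroid i j) = monom (monom 1 i) j"
proof -
  have "{1..i + j} - {1..i} = {Suc i..i + j}" by auto
  then show ?thesis
    using tutte_Pow[of "{1..i + j}" "{1..i}"]
    by (simp add: monomial_matroid_def var_x_power_var_y_power)
qed

text \<open>The map s of the overview, extended linearly from monomials.\<close>

definition bipoly_frag :: "bipoly \<Rightarrow> (nat matroid option \<Rightarrow>\<^sub>0 int)" where
  "bipoly_frag p = (\<Sum>j\<le>degree p. \<Sum>i\<le>degree (coeff p j).
     frag_cmul (coeff (coeff p j) i) (frag_of (Some (monomial_matroid i j))))"

text \<open>The summation bounds in \<open>bipoly_frag\<close> depend on the polynomial. Over a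
  fixed square of exponents the expression is linear term by term, which yields additivity.\<close>

lemma bipoly_frag_box:
  assumes "\<forall>i j. coeff (coeff p j) i \<noteq> 0 \<longrightarrow> i \<le> n \<and> j \<le> n"
  shows "bipoly_frag p = (\<Sum>j\<le>n. \<Sum>i\<le>n.
     frag_cmul (coeff (coeff p j) i) (frag_of (Some (monomial_matroid i j))))"
proof -
  have deg: "degree (coeff p j) \<le> n" for j
    using assms by (intro degree_le) force
  then have "degree p \<le> n"
    using assms by (intro degree_le) (metis leading_coeff_0_iff not_le)
  have "bipoly_frag p = (\<Sum>j\<le>degree p. \<Sum>i\<le>n.
     frag_cmul (coeff (coeff p j) i) (frag_of (Some (monomial_matroid i j))))"
    unfolding bipoly_frag_def using deg
    by (intro sum.cong sum.mono_neutral_left) (auto simp: coeff_eq_0 not_le)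
  also have "\<dots> = (\<Sum>j\<le>n. \<Sum>i\<le>n.
     frag_cmul (coeff (coeff p j) i) (frag_of (Some (monomial_matroid i j))))"
    using \<open>degree p \<le> n\<close> by (intro sum.mono_neutral_left) (auto simp: coeff_eq_0 not_le)
  finally show ?thesis .
qed

lemma bipoly_coeff_bound:
  fixes p :: bipoly
  obtains n where "\<And>i j. coeff (coeff p j) i \<noteq> 0 \<Longrightarrow> i \<le> n \<and> j \<le> n"
proof
  fix i j
  assume nz: "coeff (coeff p j) i \<noteq> 0"
  \<comment> \<open>The bound is the largest among the degree in y and the x-degrees of the
    coefficients up to it; all later coefficients vanish.\<close>
  let ?D = "insert (degree p) ((\<lambda>j. degree (coeff p j)) ` {..degree p})"
  have "i \<le> degree (coeff p j)" using nz by (rule le_degree)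
  moreover have "j \<le> degree p" using nz by (intro le_degree) auto
  moreover have "degree (coeff p j) \<le> Max ?D" "degree p \<le> Max ?D"
    using \<open>j \<le> degree p\<close> by (intro Max_ge; auto)+
  ultimately show "i \<le> Max ?D \<and> j \<le> Max ?D" by linarith
qed

lemma
  shows bipoly_frag_add: "bipoly_frag (p + q) = bipoly_frag p + bipoly_frag q"
    and bipoly_frag_diff: "bipoly_frag (p - q) = bipoly_frag p - bipoly_frag q"
proof -
  obtain m where m: "\<And>i j. coeff (coeff p j) i \<noteq> 0 \<Longrightarrow> i \<le> m \<and> j \<le> m"
    using bipoly_coeff_bound[of p] by blast
  obtain n where n: "\<And>i j. coeff (coeff q j) i \<noteq> 0 \<Longrightarrow> i \<le> n \<and> j \<le> n"
    using bipoly_coeff_bound[of q] by blast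
  define N where "N = max m n"
  have p: "\<forall>i j. coeff (coeff p j) i \<noteq> 0 \<longrightarrow> i \<le> N \<and> j \<le> N"
    using m by (fastforce simp: N_def)
  have q: "\<forall>i j. coeff (coeff q j) i \<noteq> 0 \<longrightarrow> i \<le> N \<and> j \<le> N"
    using n by (fastforce simp: N_def)
  have pq: "\<forall>i j. coeff (coeff (p + q) j) i \<noteq> 0 \<longrightarrow> i \<le> N \<and> j \<le> N"
    using p q by (metis add.right_neutral coeff_add)
  have pq': "\<forall>i j. coeff (coeff (p - q) j) i \<noteq> 0 \<longrightarrow> i \<le> N \<and> j \<le> N"
    using p q by (metis diff_self coeff_diff)
  show "bipoly_frag (p + q) = bipoly_frag p + bipoly_frag q"
    unfolding bipoly_frag_box[of p, OF p] bipoly_frag_box[of q, OF q] bipoly_frag_box[of "p + q", OF pq]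
    by (simp add: frag_cmul_distrib sum.distrib)
  show "bipoly_frag (p - q) = bipoly_frag p - bipoly_frag q"
    unfolding bipoly_frag_box[of p, OF p] bipoly_frag_box[of q, OF q] bipoly_frag_box[of "p - q", OF pq']
    by (simp add: frag_cmul_diff_distrib sum_subtractf)
qed

lemma bipoly_frag_0 [simp]: "bipoly_frag 0 = 0"
  by (simp add: bipoly_frag_def)

lemma bipoly_frag_monom:
  "bipoly_frag (monom (monom 1 i) j) = frag_of (Some (monomial_matroid i j))"
proof -
  let ?p = "monom (monom 1 i) j :: bipoly"
  have c: "coeff (coeff ?p l) k = (if k = i \<and> l = j then 1 else 0)" for k l
    by (auto simp: coeff_monom)
  have "bipoly_frag ?p = (\<Sum>l\<le>max i j. \<Sum>k\<le>max i j.
     frag_cmul (coeff (coeff ?p l) k) (frag_of (Some (monomial_matroid k l))))"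
    by (rule bipoly_frag_box) (simp add: c)
  also have "\<dots> = (\<Sum>l\<le>max i j. if l = j then frag_of (Some (monomial_matroid i j)) else 0)"
  proof (intro sum.cong refl)
    fix l
    have "(\<Sum>k\<le>max i j. frag_cmul (coeff (coeff ?p l) k) (frag_of (Some (monomial_matroid k l)))) =
        (\<Sum>k\<le>max i j. if k = i then if l = j then frag_of (Some (monomial_matroid i j)) else 0 else 0)"
      by (intro sum.cong) (auto simp: c)
    then show "(\<Sum>k\<le>max i j. frag_cmul (coeff (coeff ?p l) k) (frag_of (Some (monomial_matroid k l)))) =
        (if l = j then frag_of (Some (monomial_matroid i j)) else 0)"
      by simp
  qed
  finally show ?thesis by simp
qed

lemma keys_bipoly_frag: "Poly_Mapping.keys (bipoly_frag p) \<subseteq> Obj Mat_plus"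
proof -
  have "bipoly_frag p \<in> carrier (free_Abelian_group (Obj Mat_plus))"
    unfolding bipoly_frag_def
    by (intro sum_closed_free_Abelian_group)
       (auto simp: keys_frag_of monomial_matroid_object)
  then show ?thesis by simp
qed

text \<open>Each \<open>monomial_matroid\<close> has its monomial as Tutte polynomial, and
  \<open>p\<close> is the sum of its monomials, first in x inside every coefficient and then in
  y.\<close>

lemma lin_ext_bipoly_frag: "lin_ext tutte_value (bipoly_frag p) = p"
proof -
  have "of_int c * monom (monom 1 i) j = (monom (monom c i) j :: bipoly)" for c i j
    by (simp add: of_int_poly smult_monom)
  then have "lin_ext tutte_value (bipoly_frag p) =
      (\<Sum>j\<le>degree p. \<Sum>i\<le>degree (coeff p j). monom (monom (coeff (coeff p j) i) i) j)"
    by (simp add: bipoly_frag_def lin_ext_sum lin_ext_cmul tutte_monomial_matroid)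
  also have "\<dots> = (\<Sum>j\<le>degree p. monom (\<Sum>i\<le>degree (coeff p j). monom (coeff (coeff p j) i) i) j)"
    by (simp add: monom_sum)
  also have "\<dots> = p" by (simp add: poly_as_sum_of_monoms)
  finally show ?thesis .
qed

section \<open>The relations\<close>

lemma keys_sum_mset_frag_of:
  "Poly_Mapping.keys (\<Sum>f\<in>#Q. frag_of (g f)) \<subseteq> g ` set_mset Q"
proof (induction Q)
  case (add x Q)
  then show ?case
    using keys_add[of "frag_of (g x)" "\<Sum>f\<in>#Q. frag_of (g f)"] by (auto simp: keys_frag_of)
qed simp

lemma K0_relation_generators_closed:
  assumes "\<And>B Q. (B, Q) \<in> Covers C \<Longrightarrow> B \<in> Obj C"
    and "\<And>B Q f. (B, Q) \<in> Covers C \<Longrightarrow> f \<in># Q \<Longrightarrow> Dom C f \<in> Obj C"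
  shows "{frag_of B - (\<Sum>f\<in>#Q. frag_of (Dom C f)) | B Q. (B, Q) \<in> Covers C} \<subseteq>
    carrier (free_Abelian_group (Obj C))"
proof clarify
  fix B Q
  assume BQ: "(B, Q) \<in> Covers C"
  have "Poly_Mapping.keys (frag_of B - (\<Sum>f\<in>#Q. frag_of (Dom C f))) \<subseteq> insert B (Dom C ` set_mset Q)"
    using keys_diff[of "frag_of B" "\<Sum>f\<in>#Q. frag_of (Dom C f)"] keys_sum_mset_frag_of[of "Dom C" Q]
    by (auto simp: keys_frag_of)
  also have "\<dots> \<subseteq> Obj C" using assms(1)[OF BQ] assms(2)[OF BQ] by auto
  finally show "frag_of B - (\<Sum>f\<in>#Q. frag_of (Dom C f)) \<in> carrier (free_Abelian_group (Obj C))"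
    by simp
qed

text \<open>An additive map that respects every covering kills the generators and hence the group
  they generate. This serves for the Tutte value and for the passage to isomorphism classes.\<close>

lemma K0_relations_kernel:
  assumes gen: "{frag_of B - (\<Sum>f\<in>#Q. frag_of (Dom C f)) | B Q. (B, Q) \<in> Covers C} \<subseteq>
      carrier (free_Abelian_group (Obj C))"
    and h: "h 0 = (0::'b::ab_group_add)" "\<And>c d. h (c + d) = h c + h d" "\<And>c d. h (c - d) = h c - h d"
    and cov: "\<And>B Q. (B, Q) \<in> Covers C \<Longrightarrow> h (frag_of B) = (\<Sum>f\<in>#Q. h (frag_of (Dom C f)))"
    and c: "c \<in> K0_relations C"
  shows "h c = 0"
proof -
  have hsum: "h (\<Sum>f\<in>#Q. frag_of (Dom C f)) = (\<Sum>f\<in>#Q. h (frag_of (Dom C f)))" for Q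
    by (induction Q) (simp_all add: h)
  have h0: "h (frag_of B - (\<Sum>f\<in>#Q. frag_of (Dom C f))) = 0" if "(B, Q) \<in> Covers C" for B Q
    unfolding h(3) hsum using cov[OF that] by simp
  show ?thesis
    using c unfolding K0_relations_def
  proof (induction rule: generate.induct)
    case one
    show ?case using h(1) by simp
  next
    case (incl d)
    then show ?case using h0 by blast
  next
    case (inv d)
    \<comment> \<open>The inverse of the free abelian group is known to be negation only on its
      carrier.\<close>
    have "d \<in> carrier (free_Abelian_group (Obj C))" using gen inv by (rule subsetD)
    moreover have "h d = 0" using inv h0 by blast
    ultimately show ?case using h(1) h(3)[of 0 d] by simp
  next
    case (eng d1 d2)
    then show ?case using h(2)[of d1 d2] by simp
  qed
qed

text \<open>Both \<open>K0\<close> groups are quotients of this one group, as the two covering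
  structures live on the same category.\<close>

abbreviation "G_Mat \<equiv> free_Abelian_group (Obj Mat_plus)"

lemma iso_covers_cases:
  assumes "(B, Q) \<in> iso_covers"
  obtains (base) n where "B = None" "Q = replicate_mset n (Ident Mat_plus None)"
  | (iso) f where "B = Cod Mat_plus f" "Q = {#f#}" "iso_arrow Mat_plus f"
  using assms unfolding iso_covers_def base_covers_def by blast

lemma iso_covers_closed:
  assumes "(B, Q) \<in> iso_covers"
  shows "B \<in> Obj Mat_plus" and "f \<in># Q \<Longrightarrow> Dom Mat_plus f \<in> Obj Mat_plus"
proof -
  have "B \<in> Obj Mat_plus \<and> (f \<in># Q \<longrightarrow> Dom Mat_plus f \<in> Obj Mat_plus)"
    using assms
  proof (cases rule: iso_covers_cases)
    case base
    then show ?thesis by auto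
  next
    case (iso g)
    then show ?thesis using Mat_plus_arr_Obj[of g] by (auto simp: iso_arrow_def)
  qed
  then show "B \<in> Obj Mat_plus" and "f \<in># Q \<Longrightarrow> Dom Mat_plus f \<in> Obj Mat_plus" by auto
qed

lemma subgroup_K0_relations_Mat_tc: "subgroup (K0_relations Mat_tc) G_Mat"
  unfolding K0_relations_def
  using group.generate_is_subgroup[OF group_free_Abelian_group
      K0_relation_generators_closed[of Mat_tc]] tutte_covers_Obj by simp

lemma subgroup_K0_relations_Mat_iso: "subgroup (K0_relations Mat_iso) G_Mat"
  unfolding K0_relations_def
  using group.generate_is_subgroup[OF group_free_Abelian_group
      K0_relation_generators_closed[of Mat_iso]] iso_covers_closed by simp

lemma lin_ext_tutte_value_K0_relations_Mat_tc:
  assumes "c \<in> K0_relations Mat_tc"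
  shows "lin_ext tutte_value c = 0"
  using assms
  by (rule K0_relations_kernel[OF K0_relation_generators_closed, rotated -1])
    (simp_all add: tutte_covers_Obj lin_ext_add lin_ext_diff tutte_covers_tutte_value
      del: Mat_plus_simps)

lemma iso_class_eq:
  assumes "matroid_isomorphic M N"
  shows "iso_class M = iso_class N"
  using assms matroid_isomorphic_sym matroid_isomorphic_trans unfolding iso_class_def by blast

lemma class_of_object_iso_arrow:
  assumes "iso_arrow Mat_plus f"
  shows "class_of_object (Dom Mat_plus f) = class_of_object (Cod Mat_plus f)"
  using assms
  by (elim iso_arrow_imp_isomorphic) (auto simp: class_of_object_def dest: iso_class_eq)

text \<open>Stated for a general invariant of objects, since it is needed both for
  \<open>class_of_object\<close> and for \<open>tutte_value\<close>.\<close>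

lemma iso_covers_sum:
  fixes \<phi> :: "nat matroid option \<Rightarrow> 'b::comm_monoid_add"
  assumes "(B, Q) \<in> iso_covers" and "\<phi> None = 0"
    and "\<And>f. iso_arrow Mat_plus f \<Longrightarrow> \<phi> (Dom Mat_plus f) = \<phi> (Cod Mat_plus f)"
  shows "\<phi> B = (\<Sum>f\<in>#Q. \<phi> (Dom Mat_plus f))"
  using assms(1)
proof (cases rule: iso_covers_cases)
  case (base n)
  have "(\<Sum>f\<in>#replicate_mset n a. \<psi> f) = 0" if "\<psi> a = 0" for \<psi> :: "mat_arrow \<Rightarrow> 'b" and a
    using that by (induction n) simp_all
  then show ?thesis using base assms(2) by simp
next
  case (iso f)
  then show ?thesis using assms(3) by simp
qed

lemma
  assumes c: "c \<in> K0_relations Mat_iso"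
  shows frag_extend_class_K0_relations_Mat_iso: "frag_extend class_of_object c = 0"
    and lin_ext_tutte_value_K0_relations_Mat_iso: "lin_ext tutte_value c = 0"
proof -
  have gen: "{frag_of B - (\<Sum>f\<in>#Q. frag_of (Dom Mat_iso f)) | B Q. (B, Q) \<in> Covers Mat_iso} \<subseteq>
      carrier (free_Abelian_group (Obj Mat_iso))"
    by (rule K0_relation_generators_closed) (use iso_covers_closed in \<open>simp_all del: Mat_plus_simps\<close>)
  show "frag_extend class_of_object c = 0"
  proof (rule K0_relations_kernel[OF gen _ _ _ _ c])
    fix B Q
    assume "(B, Q) \<in> Covers Mat_iso"
    then have "(B, Q) \<in> iso_covers" by simp
    from iso_covers_sum[of B Q class_of_object, OF this _ class_of_object_iso_arrow]
    show "frag_extend class_of_object (frag_of B) =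
        (\<Sum>f\<in>#Q. frag_extend class_of_object (frag_of (Dom Mat_iso f)))"
      by (simp add: class_of_object_def)
  qed (simp_all add: frag_extend_add frag_extend_diff)
  show "lin_ext tutte_value c = 0"
  proof (rule K0_relations_kernel[OF gen _ _ _ _ c])
    fix B Q
    assume "(B, Q) \<in> Covers Mat_iso"
    then have "(B, Q) \<in> iso_covers" by simp
    from iso_covers_sum[of B Q tutte_value, OF this _ tutte_value_iso_arrow]
    show "lin_ext tutte_value (frag_of B) = (\<Sum>f\<in>#Q. lin_ext tutte_value (frag_of (Dom Mat_iso f)))"
      by simp
  qed (simp_all add: lin_ext_add lin_ext_diff)
qed

section \<open>Reduction of every object to monomial matroids\<close>

lemma K0_relations_Mat_tc_cover:
  assumes "(B, Q) \<in> tutte_covers"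
  shows "frag_of B - (\<Sum>f\<in>#Q. frag_of (Dom Mat_plus f)) \<in> K0_relations Mat_tc"
  unfolding K0_relations_def using assms by (intro generate.incl) auto

lemma
  shows K0_relations_Mat_tc_0: "0 \<in> K0_relations Mat_tc"
    and K0_relations_Mat_tc_add:
      "c \<in> K0_relations Mat_tc \<Longrightarrow> d \<in> K0_relations Mat_tc \<Longrightarrow> c + d \<in> K0_relations Mat_tc"
    and K0_relations_Mat_tc_diff:
      "c \<in> K0_relations Mat_tc \<Longrightarrow> d \<in> K0_relations Mat_tc \<Longrightarrow> c - d \<in> K0_relations Mat_tc"
    and K0_relations_Mat_tc_keys: "c \<in> K0_relations Mat_tc \<Longrightarrow> Poly_Mapping.keys c \<subseteq> Obj Mat_plus"
proof -
  interpret subgroup "K0_relations Mat_tc" G_Mat by (rule subgroup_K0_relations_Mat_tc)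
  show "0 \<in> K0_relations Mat_tc" using one_closed by simp
  show keys: "Poly_Mapping.keys c \<subseteq> Obj Mat_plus" if "c \<in> K0_relations Mat_tc" for c
    using mem_carrier[OF that] by simp
  show add: "c + d \<in> K0_relations Mat_tc" if "c \<in> K0_relations Mat_tc" "d \<in> K0_relations Mat_tc" for c d
    using m_closed[OF that] by simp
  show "c - d \<in> K0_relations Mat_tc" if "c \<in> K0_relations Mat_tc" "d \<in> K0_relations Mat_tc" for c d
    using add[OF that(1) m_inv_closed[OF that(2)]] keys[OF that(2)]
    by (simp del: Mat_plus_simps)
qed

lemma matroid_mod_K0_relations:
  assumes "M \<in> Mat_objects"
  shows "frag_of (Some M) - bipoly_frag (tutte M) \<in> K0_relations Mat_tc"
  using assms
proof (induction "card (ground M)" arbitrary: M rule: less_induct)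
  case less
  have M: "is_matroid M" using less.prems by (simp add: Mat_objects_def)
  note fin = matroid_finite_ground[OF M]
  show ?case
  proof (cases "\<exists>e. nondegenerate M e")
    case True
    then obtain e where e: "nondegenerate M e" by blast
    then have "card (ground M - {e}) < card (ground M)"
      unfolding nondegenerate_def using card_Diff1_less[OF fin] by blast
    then have D: "frag_of (Some (delete M e)) - bipoly_frag (tutte (delete M e)) \<in> K0_relations Mat_tc"
      and C: "frag_of (Some (contract M e)) - bipoly_frag (tutte (contract M e)) \<in> K0_relations Mat_tc"
      using less.hyps[of "delete M e"] Mat_objects_delete[OF less.prems]
        less.hyps[of "contract M e"] Mat_objects_contract[OF less.prems e] by simp_all
    have "frag_of (Some M) - (frag_of (Some (contract M e)) + frag_of (Some (delete M e)))
        \<in> K0_relations Mat_tc"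
      using K0_relations_Mat_tc_cover[OF deletion_contraction_cover[OF less.prems e]]
      by (simp add: inclusion_def add.commute)
    \<comment> \<open>The classes of the two minors cancel when the covering relation is added to
      the induction hypotheses, and additivity of \<open>bipoly_frag\<close> merges the remaining
      terms.\<close>
    from K0_relations_Mat_tc_add[OF this K0_relations_Mat_tc_add[OF C D]] show ?thesis
      by (simp add: tutte_nondegenerate[OF M e] bipoly_frag_add algebra_simps)
  next
    case False
    then have "\<not> nondegenerate M e" for e by blast
    from no_nondegenerate_imp_Pow[OF M this]
    obtain I where I: "I \<subseteq> ground M" "indep M = Pow I" .
    then have M_eq: "Matroid (ground M) (Pow I) = M" by (simp flip: I(2))
    define i j where "i = card I" and "j = card (ground M - I)"
    have "card (ground M) = i + j"
      using card_Diff_subset[OF finite_subset[OF I(1) fin] I(1)] card_mono[OF fin I(1)]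
      unfolding i_def j_def by simp
    then have "matroid_isomorphic (monomial_matroid i j) (Matroid (ground M) (Pow I))"
      unfolding monomial_matroid_def using I(1) fin
      by (intro isomorphic_Pow) (simp_all add: i_def)
    then have "matroid_isomorphic (monomial_matroid i j) M" unfolding M_eq .
    then obtain f where f: "iso_arrow Mat_plus (Some (monomial_matroid i j), f, Some M)"
      by (rule isomorphic_imp_iso_arrow[OF monomial_matroid_object less.prems])
    have "tutte M = monom (monom 1 i) j"
      using tutte_Pow[OF fin I(1)] unfolding M_eq i_def j_def var_x_power_var_y_power .
    then have "bipoly_frag (tutte M) = frag_of (Some (monomial_matroid i j))"
      by (simp only: bipoly_frag_monom)
    then show ?thesis
      using K0_relations_Mat_tc_cover[OF isomorphism_cover[OF monomial_matroid_object less.prems f]]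
      by simp
  qed
qed

lemma mod_K0_relations:
  assumes "Poly_Mapping.keys c \<subseteq> Obj Mat_plus"
  shows "c - bipoly_frag (lin_ext tutte_value c) \<in> K0_relations Mat_tc"
  using assms
proof (induction c rule: frag_induction)
  case zero
  then show ?case using K0_relations_Mat_tc_0 by simp
next
  case (diff c d)
  then show ?case
    using K0_relations_Mat_tc_diff[OF diff]
    by (simp add: lin_ext_diff bipoly_frag_diff algebra_simps)
next
  case (one A)
  show ?case
  proof (cases A)
    case None
    \<comment> \<open>The empty family over the base-point makes the class of the base-point itself
      a relation.\<close>
    have "(None, replicate_mset 0 (Ident Mat_plus None)) \<in> tutte_covers"
      unfolding tutte_covers_def base_covers_def by blast
    from K0_relations_Mat_tc_cover[OF this] show ?thesis by (simp add: None)
  next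
    case (Some M)
    then have "M \<in> Mat_objects" using one by auto
    from matroid_mod_K0_relations[OF this] show ?thesis by (simp add: Some)
  qed
qed

lemma K0_relations_Mat_tc_eq:
  "K0_relations Mat_tc = {c. Poly_Mapping.keys c \<subseteq> Obj Mat_plus \<and> lin_ext tutte_value c = 0}"
proof (intro Set.set_eqI iffI CollectI conjI)
  fix c
  assume "c \<in> {c. Poly_Mapping.keys c \<subseteq> Obj Mat_plus \<and> lin_ext tutte_value c = 0}"
  then have "Poly_Mapping.keys c \<subseteq> Obj Mat_plus" "lin_ext tutte_value c = 0" by blast+
  then show "c \<in> K0_relations Mat_tc" using mod_K0_relations[of c] by simp
qed (simp_all only: K0_relations_Mat_tc_keys lin_ext_tutte_value_K0_relations_Mat_tc)

section \<open>The comparison map\<close>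

text \<open>With the relations known to be a kernel, cosets are the fibres of the linear extension
  of the Tutte value.\<close>

lemma K0_coset_Mat_tc_eq:
  assumes "Poly_Mapping.keys c \<subseteq> Obj Mat_plus"
  shows "K0_coset Mat_tc c =
    {d. Poly_Mapping.keys d \<subseteq> Obj Mat_plus \<and> lin_ext tutte_value d = lin_ext tutte_value c}"
proof -
  have "d \<in> K0_coset Mat_tc c \<longleftrightarrow> d - c \<in> K0_relations Mat_tc" for d
    by (auto simp: K0_coset_def r_coset_def intro: bexI[of _ "d - c"])
  moreover have "Poly_Mapping.keys (d - c) \<subseteq> Obj Mat_plus \<longleftrightarrow> Poly_Mapping.keys d \<subseteq> Obj Mat_plus" for d
    using assms keys_diff[of d c] keys_add[of "d - c" c] by (auto simp del: Mat_plus_simps)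
  ultimately show ?thesis
    unfolding K0_relations_Mat_tc_eq by (auto simp: lin_ext_diff simp del: Mat_plus_simps)
qed

lemma carrier_K0_Mat_tc:
  "carrier (K0 Mat_tc) = K0_coset Mat_tc ` {c. Poly_Mapping.keys c \<subseteq> Obj Mat_plus}"
  by (auto simp: K0_def carrier_FactGroup K0_coset_def simp del: Mat_plus_simps)

lemma carrier_K0_Mat_iso:
  "carrier (K0 Mat_iso) = K0_coset Mat_iso ` {c. Poly_Mapping.keys c \<subseteq> Obj Mat_plus}"
  by (auto simp: K0_def carrier_FactGroup K0_coset_def simp del: Mat_plus_simps)

text \<open>Nonemptiness is what lets the union in \<open>K0_map\<close> and \<open>the_elem\<close>
  in \<open>K0_Mat_iso_ident\<close> return the common value of all representatives.\<close>

lemma K0_coset_Mat_iso_nonempty: "c \<in> K0_coset Mat_iso c"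
proof -
  have "0 \<in> K0_relations Mat_iso"
    using subgroup.one_closed[OF subgroup_K0_relations_Mat_iso] by simp
  then show ?thesis by (auto simp: K0_coset_def r_coset_def)
qed

lemma K0_coset_Mat_isoD:
  assumes "d \<in> K0_coset Mat_iso c" "Poly_Mapping.keys c \<subseteq> Obj Mat_plus"
  shows "Poly_Mapping.keys d \<subseteq> Obj Mat_plus"
    and "lin_ext tutte_value d = lin_ext tutte_value c"
    and "frag_extend class_of_object d = frag_extend class_of_object c"
proof -
  obtain r where r: "r \<in> K0_relations Mat_iso" "d = r + c"
    using assms(1) by (auto simp: K0_coset_def r_coset_def)
  have "Poly_Mapping.keys r \<subseteq> Obj Mat_plus"
    using subgroup.mem_carrier[OF subgroup_K0_relations_Mat_iso r(1)] by simp
  then show "Poly_Mapping.keys d \<subseteq> Obj Mat_plus"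
    unfolding r(2) using assms(2) keys_add[of r c] by blast
  show "lin_ext tutte_value d = lin_ext tutte_value c"
    using lin_ext_tutte_value_K0_relations_Mat_iso[OF r(1)] by (simp add: r(2) lin_ext_add)
  show "frag_extend class_of_object d = frag_extend class_of_object c"
    using frag_extend_class_K0_relations_Mat_iso[OF r(1)] by (simp add: r(2) frag_extend_add)
qed

text \<open>\<open>Gamma\<close> fixes objects, so its linear extension is the identity. All
  representatives of one isomorphism coset have the same Tutte value, so the united cosets
  coincide.\<close>

lemma gamma_K0_coset:
  assumes "Poly_Mapping.keys c \<subseteq> Obj Mat_plus"
  shows "gamma (K0_coset Mat_iso c) = K0_coset Mat_tc c"
proof -
  have "gamma (K0_coset Mat_iso c) = (\<Union>d\<in>K0_coset Mat_iso c. K0_coset Mat_tc d)"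
    by (simp add: gamma_def K0_map_def Gamma_def flip: frag_expansion)
  moreover have "K0_coset Mat_tc d = K0_coset Mat_tc c" if "d \<in> K0_coset Mat_iso c" for d
    using K0_coset_Mat_tc_eq[OF K0_coset_Mat_isoD(1)[OF that assms]] K0_coset_Mat_tc_eq[OF assms]
      K0_coset_Mat_isoD(2)[OF that assms] by simp
  then have "(\<Union>d\<in>K0_coset Mat_iso c. K0_coset Mat_tc d) = (\<Union>d\<in>K0_coset Mat_iso c. K0_coset Mat_tc c)"
    by (rule SUP_cong[OF refl])
  moreover have "K0_coset Mat_iso c \<noteq> {}" using K0_coset_Mat_iso_nonempty[of c] by blast
  ultimately show ?thesis by simp
qed

lemma K0_Mat_iso_ident_K0_coset:
  assumes "Poly_Mapping.keys c \<subseteq> Obj Mat_plus"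
  shows "K0_Mat_iso_ident (K0_coset Mat_iso c) = frag_extend class_of_object c"
proof -
  have "frag_extend class_of_object ` K0_coset Mat_iso c = {frag_extend class_of_object c}"
    using K0_coset_Mat_isoD(3)[OF _ assms] K0_coset_Mat_iso_nonempty[of c] by blast
  then show ?thesis by (simp add: K0_Mat_iso_ident_def)
qed

lemma tutte_hom_frag_extend_class:
  assumes "Poly_Mapping.keys c \<subseteq> Obj Mat_plus"
  shows "tutte_hom (frag_extend class_of_object c) = lin_ext tutte_value c"
  using assms
proof (induction c rule: frag_induction)
  case zero
  then show ?case by (simp add: tutte_hom_eq_lin_ext)
next
  case (diff c d)
  then show ?case by (simp add: tutte_hom_eq_lin_ext frag_extend_diff lin_ext_diff)
next
  case (one A)
  show ?case
  proof (cases A)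
    case None
    then show ?thesis by (simp add: tutte_hom_eq_lin_ext class_of_object_def)
  next
    case (Some M)
    then have M: "M \<in> Mat_objects" using one by auto
    \<comment> \<open>Constancy on the isomorphism class is what \<open>the_elem\<close> in
      \<open>tutte_hom\<close> relies on.\<close>
    have "tutte N = tutte M" if "N \<in> iso_class M" for N
      using that M tutte_isomorphic[of M N] by (auto simp: iso_class_def Mat_objects_def)
    moreover have "M \<in> iso_class M" using M matroid_isomorphic_refl by (simp add: iso_class_def)
    ultimately have "tutte ` iso_class M = {tutte M}" by blast
    then show ?thesis by (simp add: Some tutte_hom_eq_lin_ext class_of_object_def)
  qed
qed

section \<open>The isomorphism and its uniqueness\<close>

lemma group_Z_xy: "group Z_xy"
proof (rule groupI)
  show "\<exists>y\<in>carrier Z_xy. y \<otimes>\<^bsub>Z_xy\<^esub> x = \<one>\<^bsub>Z_xy\<^esub>" for x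
    by (rule bexI[of _ "- x"]) (simp_all add: Z_xy_def)
qed (simp_all add: Z_xy_def add.assoc)

lemma group_hom_lin_ext: "group_hom G_Mat Z_xy (lin_ext tutte_value)"
  unfolding group_hom_def group_hom_axioms_def
  using group_Z_xy by (auto simp: hom_def Z_xy_def lin_ext_add)

lemma the_elem_lin_ext_K0_coset:
  assumes "Poly_Mapping.keys c \<subseteq> Obj Mat_plus"
  shows "the_elem (lin_ext tutte_value ` K0_coset Mat_tc c) = lin_ext tutte_value c"
proof -
  have "lin_ext tutte_value ` K0_coset Mat_tc c = {lin_ext tutte_value c}"
    unfolding K0_coset_Mat_tc_eq[OF assms] using assms by auto
  then show ?thesis by simp
qed

text \<open>The first isomorphism theorem, with \<open>bipoly_frag\<close> supplying preimages for
  surjectivity.\<close>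

lemma iso_K0_Mat_tc:
  "(\<lambda>X. the_elem (lin_ext tutte_value ` X)) \<in> iso (K0 Mat_tc) Z_xy"
proof -
  interpret group_hom G_Mat Z_xy "lin_ext tutte_value" by (rule group_hom_lin_ext)
  have "kernel G_Mat Z_xy (lin_ext tutte_value) = K0_relations Mat_tc"
    by (simp add: kernel_def K0_relations_Mat_tc_eq Z_xy_def)
  moreover have "lin_ext tutte_value ` carrier G_Mat = carrier Z_xy"
  proof (intro equalityI subsetI)
    fix p
    have "bipoly_frag p \<in> carrier G_Mat" using keys_bipoly_frag by simp
    then show "p \<in> lin_ext tutte_value ` carrier G_Mat"
      by (intro image_eqI[of _ _ "bipoly_frag p"]) (simp_all only: lin_ext_bipoly_frag)
  qed (simp add: Z_xy_def)
  ultimately show ?thesis using FactGroup_iso_set by (simp add: K0_def)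
qed

lemma group_K0_Mat_tc: "group (K0 Mat_tc)"
proof -
  have "K0_relations Mat_tc \<lhd> G_Mat"
    using comm_group.normal_iff_subgroup[OF abelian_free_Abelian_group] subgroup_K0_relations_Mat_tc
    by blast
  then show ?thesis by (simp add: K0_def normal.factorgroup_is_group)
qed

theorem theoremA:
  shows "\<exists>!\<rho>. \<rho> \<in> extensional (carrier (K0 Mat_tc)) \<and>
           \<rho> \<in> iso (K0 Mat_tc) Z_xy \<and>
           (\<forall>\<xi>\<in>carrier (K0 Mat_iso). \<rho> (gamma \<xi>) = tutte_hom (K0_Mat_iso_ident \<xi>))"
proof (rule ex1I)
  let ?h = "\<lambda>X. the_elem (lin_ext tutte_value ` X)"
  \<comment> \<open>The restriction fixes the map off the carrier, so that uniqueness can be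
    equality of functions.\<close>
  let ?\<rho> = "restrict ?h (carrier (K0 Mat_tc))"
  have compat: "?\<rho> (gamma \<xi>) = tutte_hom (K0_Mat_iso_ident \<xi>)" if "\<xi> \<in> carrier (K0 Mat_iso)" for \<xi>
  proof -
    obtain c where c: "Poly_Mapping.keys c \<subseteq> Obj Mat_plus" "\<xi> = K0_coset Mat_iso c"
      using \<open>\<xi> \<in> carrier (K0 Mat_iso)\<close> unfolding carrier_K0_Mat_iso by blast
    have "K0_coset Mat_tc c \<in> carrier (K0 Mat_tc)"
      using c(1) unfolding carrier_K0_Mat_tc by blast
    then show ?thesis
      using c by (simp add: gamma_K0_coset K0_Mat_iso_ident_K0_coset tutte_hom_frag_extend_class
          the_elem_lin_ext_K0_coset del: Mat_plus_simps)
  qed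
  \<comment> \<open>The restricted map is still a homomorphism because products of cosets stay in
    the carrier.\<close>
  moreover have "?\<rho> \<in> iso (K0 Mat_tc) Z_xy"
    using iso_K0_Mat_tc monoid.m_closed[OF group.is_monoid[OF group_K0_Mat_tc]]
    by (auto simp: iso_def hom_def cong: bij_betw_cong)
  ultimately show "?\<rho> \<in> extensional (carrier (K0 Mat_tc)) \<and> ?\<rho> \<in> iso (K0 Mat_tc) Z_xy \<and>
      (\<forall>\<xi>\<in>carrier (K0 Mat_iso). ?\<rho> (gamma \<xi>) = tutte_hom (K0_Mat_iso_ident \<xi>))"
    by blast
  fix \<rho>
  assume \<rho>: "\<rho> \<in> extensional (carrier (K0 Mat_tc)) \<and> \<rho> \<in> iso (K0 Mat_tc) Z_xy \<and>
    (\<forall>\<xi>\<in>carrier (K0 Mat_iso). \<rho> (gamma \<xi>) = tutte_hom (K0_Mat_iso_ident \<xi>))"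
  show "\<rho> = ?\<rho>"
  proof (rule extensionalityI[of _ "carrier (K0 Mat_tc)"])
    fix X
    assume "X \<in> carrier (K0 Mat_tc)"
    then obtain c where c: "Poly_Mapping.keys c \<subseteq> Obj Mat_plus" "X = K0_coset Mat_tc c"
      unfolding carrier_K0_Mat_tc by blast
    \<comment> \<open>Surjectivity of \<open>gamma\<close>: the same representative defines a coset
      on the isomorphism side, where the compatibility condition prescribes the value.\<close>
    then have "X = gamma (K0_coset Mat_iso c)" "K0_coset Mat_iso c \<in> carrier (K0 Mat_iso)"
      using gamma_K0_coset[OF c(1)] unfolding carrier_K0_Mat_iso by auto
    then show "\<rho> X = ?\<rho> X" using \<rho> compat by metis
  qed (use \<rho> in simp_all)
qed

end
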